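(* Consider Brochette first-passage percolation on $\mathbb{Z}^d$, $d\ge2$, with passage time distribution function $F$, and let $a$ be the infimum of the support of this distribution. Assume that $\mathbb{E}[\min(\tau_1^d,\dots,\tau_d^d)]<+\infty$, where $\tau_1,\dots,\tau_d$ are independent random variables with distribution function $F$. Let $\Diamond=\{x\in\mathbb{R}^d:\lVert x\rVert_1\le 1\}$. If $a>0$, then for all $\epsilon>0$, $$\mathbb{P}\left(\frac{1-\epsilon}{a}\Diamond\subset\frac{B_t}{t}\subset\frac1a\Diamond\ \text{ for all large } t\right)=1.$$ Furthermore, if $a=0$, then for all $M>0$, $$\mathbb{P}\left(M\Diamond\subset\frac{B_t}{t}\ \text{ for all large } t\right)=1.$$
   Context: Brochette first-passage percolation: let $\mathbb{E}^d$ be the set of edges $\{x,y\}$ with $x,y\in\mathbb{Z}^d$, $\lVert x-y\rVert_1=1$. An integer line is the set of points of $\mathbb{Z}^d$ lying on a common line of $\mathbb{R}^d$ parallel to one of the coordinate axes; $\Delta$ is the set of integer lines. Let $(\tau_\delta)_{\delta\in\Delta}$ be i.i.d. random variables with values in $[0,+\infty)$ and common cumulative distribution function $F$. The passage time $\tau_e$ of an edge $e\in\mathbb{E}^d$ is $\tau_e=\tau_\delta$, where $\delta$ is the unique integer line containing both endpoints of $e$. The infimum $a\ge 0$ of the support satisfies $F(a+\eta)>0$ and $F(a-\eta)=0$ for all $\eta>0$. For $x\in\mathbb{R}^d$ let $x'$ be the unique vertex of $\mathbb{Z}^d$ with $x\in x'+[0,1)^d$. For $x,y\in\mathbb{R}^d$,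 $T(x,y)=\inf_\Gamma\sum_{e\in\Gamma}\tau_e$, the infimum being over finite nearest-neighbour paths $\Gamma$ in $\mathbb{Z}^d$ from $x'$ to $y'$ (so $T(x,y)=0$ if $x'=y'$). For $t\ge0$, $B_t=\{x\in\mathbb{R}^d: T(0,x)\le t\}$ is the random ball, and $\frac{B_t}{t}=\{x/t: x\in B_t\}$ for $t>0$. "For all large $t$" means: there exists a (random) $t_0$ such that the property holds for all $t\ge t_0$.
   Formalization: As B_t is a union of unit cells, B_t/t ⊂ (1/a)◇ fails by rounding (e.g. τ ≡ a); proved instead: (B_t∩Z^d)/t ⊂ (1/a)◇ and B_t/t ⊂ (1/a)◇ + (1/t)[0,1)^d. For ε > 1, ((1-ε)/a)◇ is read as empty. *)

theory Defs
  imports "HOL-Probability.Probability"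
begin

definition iid_with_cdf ::
    "'w measure \<Rightarrow> ('i \<Rightarrow> 'w \<Rightarrow> real) \<Rightarrow> 'i set \<Rightarrow> (real \<Rightarrow> real) \<Rightarrow> bool" where
  "iid_with_cdf M X I F \<longleftrightarrow>
     prob_space M \<and>
     prob_space.indep_vars M (\<lambda>_. borel) X I \<and>
     (\<forall>i\<in>I. cdf (distr M borel (X i)) = F)"

definition measure_support :: "'a::topological_space measure \<Rightarrow> 'a set" where
  "measure_support \<mu> = {x. \<forall>U. open U \<longrightarrow> x \<in> U \<longrightarrow> emeasure \<mu> U > 0}"

definition lattice_edges :: "(int ^ 'n) set set" where
  "lattice_edges = {{x, y} | x y. (\<Sum>i\<in>UNIV. \<bar>x $ i - y $ i\<bar>) = 1}"

definition integer_lines :: "(int ^ 'n) set set" where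
  "integer_lines = {{x. \<forall>j. j \<noteq> i \<longrightarrow> x $ j = p $ j} | p i. True}"

definition brochette_fpp ::
    "'w measure \<Rightarrow> ((int ^ 'n) set \<Rightarrow> 'w \<Rightarrow> real) \<Rightarrow> (real \<Rightarrow> real) \<Rightarrow> bool" where
  "brochette_fpp M \<tau> F \<longleftrightarrow>
     iid_with_cdf M \<tau> integer_lines F \<and>
     (\<forall>\<delta>\<in>integer_lines. \<forall>\<omega>\<in>space M. 0 \<le> \<tau> \<delta> \<omega>)"

text \<open>In the following, \<open>w\<close> is one realisation \<open>\<lambda>\<delta>. \<tau> \<delta> \<omega>\<close> of the line passage times.\<close>

definition edge_time :: "((int ^ 'n) set \<Rightarrow> real) \<Rightarrow> (int ^ 'n) set \<Rightarrow> real" where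
  "edge_time w e = w (THE \<delta>. \<delta> \<in> integer_lines \<and> e \<subseteq> \<delta>)"

definition lattice_paths :: "int ^ 'n \<Rightarrow> int ^ 'n \<Rightarrow> (int ^ 'n) list set" where
  "lattice_paths u v =
     {p. p \<noteq> [] \<and> hd p = u \<and> last p = v \<and> successively (\<lambda>x y. {x, y} \<in> lattice_edges) p}"

definition path_time :: "((int ^ 'n) set \<Rightarrow> real) \<Rightarrow> (int ^ 'n) list \<Rightarrow> real" where
  "path_time w p = (\<Sum>(x, y)\<leftarrow>zip p (tl p). edge_time w {x, y})"

text \<open>The vertex \<open>x'\<close> with \<open>x \<in> x' + [0,1)\<^sup>d\<close>.\<close>

definition cell_vertex :: "real ^ 'n \<Rightarrow> int ^ 'n" where
  "cell_vertex x = (\<chi> i. \<lfloor>x $ i\<rfloor>)"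

definition passage_time :: "((int ^ 'n) set \<Rightarrow> real) \<Rightarrow> real ^ 'n \<Rightarrow> real ^ 'n \<Rightarrow> real" where
  "passage_time w x y = (INF p\<in>lattice_paths (cell_vertex x) (cell_vertex y). path_time w p)"

definition fpp_ball :: "((int ^ 'n) set \<Rightarrow> real) \<Rightarrow> real \<Rightarrow> (real ^ 'n) set" where
  "fpp_ball w t = {x. passage_time w 0 x \<le> t}"

definition scaled :: "real \<Rightarrow> (real ^ 'n) set \<Rightarrow> (real ^ 'n) set" where
  "scaled c S = (\<lambda>x. c *\<^sub>R x) ` S"

text \<open>
  \<open>diamond r\<close> is the multiple \<open>r \<Diamond>\<close> of the unit ball of the 1-norm, with \<open>r \<Diamond>\<close> empty for
  \<open>r < 0\<close>. The pointwise multiple would not do for negative \<open>r\<close>: it is the ball of radius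
  \<open>- r\<close>, so that \<open>((1 - \<epsilon>) / a) \<Diamond>\<close> would be larger than \<open>(1 / a) \<Diamond>\<close> for \<open>\<epsilon> > 2\<close>.
\<close>

definition diamond :: "real \<Rightarrow> (real ^ 'n) set" where
  "diamond r = {x. (\<Sum>i\<in>UNIV. \<bar>x $ i\<bar>) \<le> r}"

lemma diamond_eq_scaled:
  assumes "r \<ge> 0"
  shows "diamond r = scaled r (diamond 1 :: (real ^ 'n) set)"
proof (cases "r = 0")
  case True
  have "x = 0" if "(\<Sum>i\<in>UNIV. \<bar>x $ i\<bar>) \<le> 0" for x :: "real ^ 'n"
  proof -
    have "(\<Sum>i\<in>UNIV. \<bar>x $ i\<bar>) = 0"
      using that by (simp add: antisym sum_nonneg)
    then show ?thesis
      by (simp add: sum_nonneg_eq_0_iff vec_eq_iff)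
  qed
  then have "diamond 0 = {0 :: real ^ 'n}"
    by (auto simp: diamond_def)
  moreover have "scaled 0 (diamond 1) = {0 :: real ^ 'n}"
  proof -
    have "(0 :: real ^ 'n) \<in> diamond 1"
      by (simp add: diamond_def)
    then show ?thesis
      unfolding scaled_def by auto
  qed
  ultimately show ?thesis
    using True by simp
next
  case False
  with assms have r: "r > 0" by simp
  show ?thesis
  proof (intro subset_antisym subsetI)
    fix x :: "real ^ 'n" assume "x \<in> diamond r"
    then have "(1 / r) *\<^sub>R x \<in> diamond 1"
      using r by (simp add: diamond_def abs_mult sum_divide_distrib[symmetric])
    moreover have "x = r *\<^sub>R ((1 / r) *\<^sub>R x)" using r by simp
    ultimately show "x \<in> scaled r (diamond 1)"
      unfolding scaled_def by blast
  next
    fix x :: "real ^ 'n" assume "x \<in> scaled r (diamond 1)"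
    then show "x \<in> diamond r"
      using r by (auto simp: diamond_def scaled_def abs_mult sum_distrib_left[symmetric])
  qed
qed

text \<open>
  The ball \<open>fpp_ball w t\<close> is a union of cells \<open>v + [0,1)\<^sup>d\<close>, and the inequality
  \<open>a \<parallel>x'\<parallel>\<^sub>1 \<le> T(0,x)\<close> bounds the vertex \<open>x'\<close>, not \<open>x\<close> itself. Hence
  \<open>B\<^sub>t / t \<subseteq> (1/a) \<Diamond>\<close> can fail by the rounding: if all passage times equal \<open>a\<close> and
  \<open>t = n a\<close>, then \<open>B\<^sub>t\<close> contains \<open>(n + 1/2) e\<^sub>1\<close>, whose 1-norm exceeds \<open>t / a\<close>. The
  sets \<open>lattice_points\<close> and \<open>unit_cell\<close> serve to state the inclusion exactly for the
  vertices in \<open>B\<^sub>t\<close>, and up to one cell for all its points.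
\<close>

definition lattice_points :: "(real ^ 'n) set" where
  "lattice_points = {x. \<forall>i. x $ i \<in> \<int>}"

definition unit_cell :: "(real ^ 'n) set" where
  "unit_cell = {x. \<forall>i. 0 \<le> x $ i \<and> x $ i < 1}"

end

theory Submission
  imports Defs "HOL-Real_Asymp.Real_Asymp"
begin

text \<open>
  The inclusions of the ball in the diamond need only that, almost surely, every line time is at
  least \<open>a\<close>: a path from \<open>0\<close> to \<open>v\<close> has at least \<open>\<parallel>v\<parallel>\<^sub>1\<close> edges.

  The inclusion of the diamond in the ball needs a reason for passage times to be as small as
  \<open>(a + \<eta>) \<parallel>v\<parallel>\<^sub>1\<close>. The reason is that a line serves all its edges at the same speed. Call a line
  fast if its time is at most \<open>b = a + \<eta>\<close>; this has positive probability. Walking along a line, one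
  crosses independent lines of every other direction, so a fast one of any prescribed direction
  appears after few steps. A traveller on a fast line can therefore clear the
  coordinates one after another: ride the fast line of direction \<open>k\<close> until coordinate \<open>k\<close> vanishes,
  walk a little further to a fast line of the next direction, and so on
  (\<open>clear_coordinates\<close>). The total length is about \<open>\<parallel>v\<parallel>\<^sub>1\<close>, and every edge costs at most \<open>b\<close>.

  What remains is to leave \<open>v\<close>, where all lines could be slow, and to reach \<open>0\<close> exactly.

  Leaving \<open>v\<close> is where the moment is used. Summed over \<open>v\<close>, the probabilities that all \<open>d\<close>
  lines through \<open>v\<close> have time above \<open>c \<parallel>v\<parallel>\<^sub>1\<close> are bounded by the expected number of \<open>v\<close> with
  \<open>(c \<parallel>v\<parallel>\<^sub>1)\<^sup>d < min(\<tau>\<^sub>1\<^sup>d, \<dots>, \<tau>\<^sub>d\<^sup>d)\<close>, which is finite; hence all but finitely many \<open>v\<close>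
  have a line of time at most \<open>c \<parallel>v\<parallel>\<^sub>1\<close> (\<open>AE_slow_stars_finite\<close>). Such a line is still
  too slow for a search whose length grows with \<open>v\<close>, so there is an intermediate scale. Let
  \<open>k\<^sup>3 \<le> \<parallel>v\<parallel>\<^sub>1 < (k + 1)\<^sup>3\<close>. By Markov's inequality \<open>P(\<tau> > k)\<close> is at most of order \<open>1/k\<close>, so a fixed
  number \<open>K\<close> of crossings makes the probability to meet no line of time at most \<open>k\<close> a high
  negative power of \<open>k\<close>, which beats the polynomial number of starting points. On that
  line a search of \<open>k\<close> steps costs only \<open>k\<^sup>2\<close>, and fails to meet a fast line with exponentially
  small probability. With \<open>c = \<eta> / K\<close> the departure costs \<open>\<eta> \<parallel>v\<parallel>\<^sub>1 + O(k\<^sup>2)\<close>.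

  Reaching \<open>0\<close> is an induction. The journey ends at some \<open>u\<close> with \<open>\<parallel>u\<parallel>\<^sub>1 = O(k)\<close>
  (\<open>contraction_step\<close>), much nearer to \<open>0\<close> than \<open>v\<close>, and the linear bound for \<open>u\<close> costs only
  \<open>O(k)\<close>, which like \<open>O(k\<^sup>2)\<close> is absorbed in \<open>\<eta> k\<^sup>3\<close> for large \<open>k\<close>. So
  \<open>T(0, v) \<le> c\<^sub>0 + (b + 2 \<eta>) \<parallel>v\<parallel>\<^sub>1\<close> for all \<open>v\<close>, with a random constant \<open>c\<^sub>0\<close> that accounts for the
  finitely many exceptional \<open>v\<close> (\<open>reach_linear_bound\<close>). The cases \<open>a > 0\<close> and \<open>a = 0\<close> differ only
  in the choice of \<open>\<eta>\<close>.
\<close>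

section \<open>Lines and paths in the integer lattice\<close>

definition line :: "'n \<Rightarrow> int ^ 'n \<Rightarrow> (int ^ 'n) set" where
  "line i x = {y. \<forall>j. j \<noteq> i \<longrightarrow> y $ j = x $ j}"

definition set_coord :: "'n \<Rightarrow> int \<Rightarrow> int ^ 'n \<Rightarrow> int ^ 'n" where
  "set_coord i t x = (\<chi> j. if j = i then t else x $ j)"

definition norm1 :: "int ^ 'n \<Rightarrow> int" where
  "norm1 x = (\<Sum>i\<in>UNIV. \<bar>x $ i\<bar>)"

text \<open>
  A bound on the infimum of path times is always obtained from one path, so the construction
  works with the existence of a path of bounded time and passes to \<open>passage_time\<close> only at the end.
\<close>
definition reach :: "((int ^ 'n) set \<Rightarrow> real) \<Rightarrow> int ^ 'n \<Rightarrow> int ^ 'n \<Rightarrow> real \<Rightarrow> bool" where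
  "reach w u v c \<longleftrightarrow> (\<exists>p\<in>lattice_paths u v. path_time w p \<le> c)"

lemma set_coord_nth [simp]: "set_coord i t x $ j = (if j = i then t else x $ j)"
  by (simp add: set_coord_def)

lemma set_coord_set_coord [simp]: "set_coord i s (set_coord i t x) = set_coord i s x"
  by (simp add: vec_eq_iff)

lemma set_coord_same [simp]: "set_coord i (x $ i) x = x"
  by (simp add: vec_eq_iff)

lemma line_set_coord [simp]: "line i (set_coord i t x) = line i x"
  by (auto simp: line_def)

lemma line_in_integer_lines [simp]: "line i x \<in> integer_lines"
  unfolding line_def integer_lines_def by blast

lemma integer_linesE:
  assumes "\<delta> \<in> integer_lines"
  obtains i x where "\<delta> = line i x"
  using assms unfolding line_def integer_lines_def by blast

lemma norm1_nonneg [simp]: "0 \<le> norm1 x"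
  by (simp add: norm1_def sum_nonneg)

lemma norm1_zero [simp]: "norm1 0 = 0"
  by (simp add: norm1_def)

lemma abs_nth_le_norm1: "\<bar>x $ i\<bar> \<le> norm1 x"
  unfolding norm1_def by (rule member_le_sum) auto

lemma norm1_triangle: "norm1 (x + y) \<le> norm1 x + norm1 y"
  unfolding norm1_def sum.distrib[symmetric] by (rule sum_mono) simp

lemma norm1_set_coord_le: "norm1 (set_coord i t x) \<le> norm1 x + \<bar>t - x $ i\<bar>"
proof -
  have "norm1 (set_coord i t x) = \<bar>t\<bar> + (\<Sum>j\<in>UNIV - {i}. \<bar>x $ j\<bar>)"
    unfolding norm1_def by (subst sum.remove[of _ i]) auto
  moreover have "norm1 x = \<bar>x $ i\<bar> + (\<Sum>j\<in>UNIV - {i}. \<bar>x $ j\<bar>)"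
    unfolding norm1_def by (subst sum.remove[of _ i]) auto
  ultimately show ?thesis by linarith
qed

lemma lattice_edge_iff: "{x, y} \<in> lattice_edges \<longleftrightarrow> norm1 (y - x) = 1"
proof -
  have "{x, y} \<in> lattice_edges \<longleftrightarrow> norm1 (x - y) = 1 \<or> norm1 (y - x) = 1"
    unfolding lattice_edges_def norm1_def by (auto simp: doubleton_eq_iff)
  moreover have "norm1 (x - y) = norm1 (y - x)"
    by (simp add: norm1_def abs_minus_commute)
  ultimately show ?thesis by simp
qed

lemma lattice_edge_set_coord:
  assumes "\<bar>t - x $ i\<bar> = 1"
  shows "{x, set_coord i t x} \<in> lattice_edges"
proof -
  have "norm1 (set_coord i t x - x) = (\<Sum>j\<in>UNIV. if j = i then \<bar>t - x $ i\<bar> else 0)"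
    unfolding norm1_def by (rule sum.cong) auto
  then show ?thesis
    using assms by (simp add: lattice_edge_iff)
qed

lemma lattice_edgeE:
  assumes "{x, y} \<in> lattice_edges"
  obtains i where "y = set_coord i (y $ i) x" "\<bar>y $ i - x $ i\<bar> = 1"
proof -
  have sum1: "(\<Sum>j\<in>UNIV. \<bar>(y - x) $ j\<bar>) = 1"
    using assms by (simp add: lattice_edge_iff norm1_def)
  then obtain i where i: "\<bar>(y - x) $ i\<bar> \<noteq> 0"
    by (metis sum.neutral zero_neq_one)
  have "(\<Sum>j\<in>UNIV. \<bar>(y - x) $ j\<bar>) = \<bar>(y - x) $ i\<bar> + (\<Sum>j\<in>UNIV - {i}. \<bar>(y - x) $ j\<bar>)"
    by (subst sum.remove[of _ i]) auto
  moreover have "(\<Sum>j\<in>UNIV - {i}. \<bar>(y - x) $ j\<bar>) \<ge> 0"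
    by (simp add: sum_nonneg)
  ultimately have 1: "\<bar>(y - x) $ i\<bar> = 1" and 0: "(\<Sum>j\<in>UNIV - {i}. \<bar>(y - x) $ j\<bar>) = 0"
    using i sum1 by linarith+
  have "y $ j = x $ j" if "j \<noteq> i" for j
    using 0 that by (simp add: sum_nonneg_eq_0_iff)
  then have "y = set_coord i (y $ i) x"
    by (simp add: vec_eq_iff)
  with 1 that show thesis by simp
qed

lemma line_eqI:
  assumes "y \<in> line i x"
  shows "line i y = line i x"
  using assms by (auto simp: line_def)

text \<open>
  Any integer line through both points has direction \<open>i\<close>, since a line of another direction
  fixes coordinate \<open>i\<close>, in which the points differ. This makes \<open>edge_time\<close>, a definite
  description, computable.
\<close>
lemma edge_time_set_coord:
  assumes "t \<noteq> x $ i"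
  shows "edge_time w {x, set_coord i t x} = w (line i x)"
proof -
  have "(THE \<delta>. \<delta> \<in> integer_lines \<and> {x, set_coord i t x} \<subseteq> \<delta>) = line i x"
  proof (rule the_equality)
    show "line i x \<in> integer_lines \<and> {x, set_coord i t x} \<subseteq> line i x"
      by simp (simp add: line_def)
  next
    fix \<delta> assume \<delta>: "\<delta> \<in> integer_lines \<and> {x, set_coord i t x} \<subseteq> \<delta>"
    then obtain j z where jz: "\<delta> = line j z"
      by (blast elim: integer_linesE)
    have mem: "x \<in> line j z" "set_coord i t x \<in> line j z"
      using \<delta> jz by auto
    have "j = i"
      using mem assms unfolding line_def by (cases "j = i") (auto simp: split: if_splits)
    then show "\<delta> = line i x"
      using jz mem(1) line_eqI by blast
  qed
  then show ?thesis
    by (simp add: edge_time_def)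
qed

lemma path_time_Cons:
  "path_time w (x # y # p) = edge_time w {x, y} + path_time w (y # p)"
  by (simp add: path_time_def)

lemma path_time_single [simp]: "path_time w [x] = 0"
  by (simp add: path_time_def)

lemma lattice_paths_Cons:
  "x # y # p \<in> lattice_paths u v \<longleftrightarrow> x = u \<and> {u, y} \<in> lattice_edges \<and> y # p \<in> lattice_paths y v"
  by (auto simp: lattice_paths_def)

lemma lattice_paths_single: "[x] \<in> lattice_paths u v \<longleftrightarrow> x = u \<and> x = v"
  by (auto simp: lattice_paths_def)

text \<open>
  Every edge changes the 1-norm distance to \<open>v\<close> by at most one and costs at least \<open>a\<close>.
\<close>
lemma path_time_ge:
  assumes "p \<in> lattice_paths u v" and w: "\<And>\<delta>. \<delta> \<in> integer_lines \<Longrightarrow> a \<le> w \<delta>" and "0 \<le> a"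
  shows "a * real_of_int (norm1 (v - u)) \<le> path_time w p"
  using assms(1)
proof (induction p arbitrary: u)
  case Nil
  then show ?case by (simp add: lattice_paths_def)
next
  case (Cons x p)
  show ?case
  proof (cases p)
    case Nil
    then show ?thesis
      using Cons.prems by (auto simp: lattice_paths_single)
  next
    case (Cons y q)
    with Cons.prems have xu: "x = u" and e: "{u, y} \<in> lattice_edges" and p: "p \<in> lattice_paths y v"
      by (auto simp: lattice_paths_Cons)
    obtain i where i: "y = set_coord i (y $ i) u" "\<bar>y $ i - u $ i\<bar> = 1"
      using e by (rule lattice_edgeE)
    have "edge_time w {u, y} = w (line i u)"
      by (subst i(1), rule edge_time_set_coord) (use i in auto)
    then have "a \<le> edge_time w {u, y}"
      using w by simp
    moreover have "a * real_of_int (norm1 (v - y)) \<le> path_time w p"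
      by (rule Cons.IH[OF p])
    moreover have "norm1 (v - u) \<le> norm1 (v - y) + 1"
      using norm1_triangle[of "v - y" "y - u"] e by (simp add: lattice_edge_iff)
    then have "a * real_of_int (norm1 (v - u)) \<le> a * (real_of_int (norm1 (v - y)) + 1)"
      using \<open>0 \<le> a\<close> by (intro mult_left_mono) linarith+
    ultimately show ?thesis
      unfolding Cons xu path_time_Cons by (simp add: algebra_simps)
  qed
qed

lemma reach_refl: "0 \<le> c \<Longrightarrow> reach w u u c"
  unfolding reach_def by (intro bexI[of _ "[u]"]) (auto simp: lattice_paths_single)

lemma reach_mono: "reach w u v c \<Longrightarrow> c \<le> c' \<Longrightarrow> reach w u v c'"
  unfolding reach_def by force

lemma reach_Cons:
  assumes "{u, y} \<in> lattice_edges" "reach w y v c"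
  shows "reach w u v (edge_time w {u, y} + c)"
proof -
  obtain p where p: "p \<in> lattice_paths y v" "path_time w p \<le> c"
    using assms(2) unfolding reach_def by blast
  then obtain q where q: "p = y # q"
    by (cases p) (auto simp: lattice_paths_def)
  show ?thesis
    unfolding reach_def
    by (rule bexI[of _ "u # y # q"]) (use p q assms in \<open>auto simp: path_time_Cons lattice_paths_Cons\<close>)
qed

lemma reach_trans:
  assumes "reach w u v c" "reach w v z c'"
  shows "reach w u z (c + c')"
proof -
  have "reach w u z (path_time w p + c')" if "p \<in> lattice_paths u v" for p
    using that
  proof (induction p arbitrary: u)
    case Nil
    then show ?case by (simp add: lattice_paths_def)
  next
    case (Cons x p)
    show ?case
    proof (cases p)
      case Nil
      then show ?thesis
        using Cons.prems assms(2) by (auto simp: lattice_paths_single)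
    next
      case (Cons y q)
      with Cons.prems have xu: "x = u" and e: "{u, y} \<in> lattice_edges" and p: "p \<in> lattice_paths y v"
        by (auto simp: lattice_paths_Cons)
      from reach_Cons[OF e Cons.IH[OF p]] show ?thesis
        by (simp add: Cons xu path_time_Cons add.assoc)
    qed
  qed
  then show ?thesis
    using assms(1) reach_mono unfolding reach_def by (metis add_right_mono)
qed

text \<open>
  Riding along one line costs its time once per step; here \<open>t\<close> may lie on either side of
  \<open>x $ i\<close>.
\<close>
lemma reach_line: "reach w x (set_coord i t x) (\<bar>real_of_int (t - x $ i)\<bar> * w (line i x))"
proof (induction "nat \<bar>t - x $ i\<bar>" arbitrary: x)
  case 0
  then have "t = x $ i" by simp
  then show ?case by (auto intro: reach_refl)
next
  case (Suc n)
  define s where "s = x $ i + sgn (t - x $ i)"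
  have ne: "t \<noteq> x $ i" using Suc.hyps(2) by auto
  have s: "\<bar>s - x $ i\<bar> = 1" "\<bar>t - s\<bar> = int n" "\<bar>t - x $ i\<bar> = int n + 1"
    using ne Suc.hyps(2) by (auto simp: s_def sgn_if)
  have "reach w (set_coord i s x) (set_coord i t (set_coord i s x))
      (\<bar>real_of_int (t - set_coord i s x $ i)\<bar> * w (line i (set_coord i s x)))"
    by (rule Suc.hyps(1)) (use s in auto)
  then have "reach w (set_coord i s x) (set_coord i t x) (real n * w (line i x))"
    using s by (simp flip: of_int_diff of_int_abs)
  from reach_Cons[OF lattice_edge_set_coord[OF s(1)] this]
  have "reach w x (set_coord i t x) (w (line i x) + real n * w (line i x))"
    using s(1) by (subst (asm) edge_time_set_coord) auto
  moreover have "\<bar>real_of_int (t - x $ i)\<bar> = real n + 1"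
    using s(3) by (simp flip: of_int_diff of_int_abs)
  ultimately show ?case
    by (simp add: algebra_simps)
qed

lemma reach_line_back: "reach w (set_coord i t x) x (\<bar>real_of_int (t - x $ i)\<bar> * w (line i x))"
  using reach_line[of w "set_coord i t x" i "x $ i"] by (simp add: abs_minus_commute)

lemma ex_reach: "\<exists>c. reach w u v c"
proof -
  have "finite S \<Longrightarrow> \<exists>c. reach w u (\<chi> i. if i \<in> S then v $ i else u $ i) c" for S
  proof (induction S rule: finite_induct)
    case empty
    have "(\<chi> i. if i \<in> {} then v $ i else u $ i) = u" by (simp add: vec_eq_iff)
    then show ?case using reach_refl by fastforce
  next
    case (insert k S)
    have "(\<chi> i. if i \<in> insert k S then v $ i else u $ i) = set_coord k (v $ k) (\<chi> i. if i \<in> S then v $ i else u $ i)"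
      by (auto simp: vec_eq_iff)
    then show ?case
      using insert.IH reach_trans[OF _ reach_line] by force
  qed
  from this[of UNIV] show ?thesis by simp
qed

lemma passage_time_le:
  assumes "\<And>\<delta>. \<delta> \<in> integer_lines \<Longrightarrow> 0 \<le> w \<delta>" "reach w (cell_vertex x) (cell_vertex y) c"
  shows "passage_time w x y \<le> c"
proof -
  obtain p where p: "p \<in> lattice_paths (cell_vertex x) (cell_vertex y)" "path_time w p \<le> c"
    using assms(2) unfolding reach_def by blast
  have "bdd_below (path_time w ` lattice_paths (cell_vertex x) (cell_vertex y))"
    by (rule bdd_belowI2[of _ 0]) (use path_time_ge[of _ _ _ 0 w] assms(1) in force)
  with p show ?thesis
    unfolding passage_time_def by (rule cINF_lower2[rotated])
qed

lemma passage_time_ge: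
  assumes "\<And>\<delta>. \<delta> \<in> integer_lines \<Longrightarrow> a \<le> w \<delta>" "0 \<le> a"
  shows "a * real_of_int (norm1 (cell_vertex y - cell_vertex x)) \<le> passage_time w x y"
  unfolding passage_time_def
proof (rule cINF_greatest)
  show "lattice_paths (cell_vertex x) (cell_vertex y) \<noteq> {}"
    using ex_reach[of w "cell_vertex x" "cell_vertex y"] unfolding reach_def by blast
qed (use assms path_time_ge in blast)

section \<open>Navigation along fast lines\<close>

definition box :: "nat \<Rightarrow> (int ^ 'n) set" where
  "box R = {x. \<forall>i. \<bar>x $ i\<bar> \<le> int R}"

lemma mem_boxI: "norm1 x \<le> int R \<Longrightarrow> x \<in> box R"
  using abs_nth_le_norm1 order_trans unfolding box_def by blast

lemma card_box: "card (box R :: (int ^ 'n) set) = (2 * R + 1) ^ CARD('n)"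
  and finite_box: "finite (box R :: (int ^ 'n) set)"
proof -
  have bij: "bij_betw vec_nth (box R :: (int ^ 'n) set) (PiE UNIV (\<lambda>_. {- int R..int R}))"
    by (rule bij_betwI[of _ _ _ vec_lambda]) (auto simp: box_def abs_le_iff PiE_iff minus_le_iff)
  have "card (box R :: (int ^ 'n) set) = card (PiE (UNIV :: 'n set) (\<lambda>_. {- int R..int R}))"
    using bij by (rule bij_betw_same_card)
  also have "\<dots> = nat (2 * int R + 1) ^ CARD('n)"
    by (simp add: card_PiE)
  also have "nat (2 * int R + 1) = 2 * R + 1" by simp
  finally show "card (box R :: (int ^ 'n) set) = (2 * R + 1) ^ CARD('n)" .
  show "finite (box R :: (int ^ 'n) set)"
    using bij bij_betw_finite finite_PiE by (metis finite_atLeastAtMost_int finite)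
qed

text \<open>
  The requirement is uniform over the box because a search starts where the previous one ended,
  at a point that depends on the line times.
\<close>
definition crossings ::
    "((int ^ 'n) set \<Rightarrow> real) \<Rightarrow> nat \<Rightarrow> nat \<Rightarrow> real \<Rightarrow> bool" where
  "crossings w R m r \<longleftrightarrow>
     (\<forall>x\<in>box R. \<forall>i j. i \<noteq> j \<longrightarrow> (\<exists>s<m. w (line j (set_coord i (x $ i + int s) x)) \<le> r))"

lemma crossingsE:
  assumes "crossings w R m r" "x \<in> box R" "i \<noteq> j"
  obtains s where "s < m" "w (line j (set_coord i (x $ i + int s) x)) \<le> r"
  using assms unfolding crossings_def by blast

text \<open>
  Starting on a fast line, the coordinates in \<open>S\<close> are brought close to \<open>0\<close> one at a time. A
  change of direction moves the point by at most \<open>m\<close> along the line that is left, and every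
  coordinate in turn is then set to \<open>0\<close>; so after \<open>card S\<close> rounds no coordinate in \<open>S\<close> is further than
  \<open>card S * m\<close> from \<open>0\<close>, and no other one has grown by more. The path
  is built from its end, from \<open>y\<close> back to \<open>x\<close>, because the induction of \<open>reach_linear_bound\<close>
  prepends a path from the origin to \<open>y\<close>.
\<close>
lemma clear_coordinates:
  fixes w :: "(int ^ 'n) set \<Rightarrow> real"
  assumes cr: "crossings w R m b" and b: "0 \<le> b"
    and x: "\<And>k. \<bar>x $ k\<bar> + int (CARD('n) * m) \<le> int R" and l: "w (line l x) \<le> b"
  shows "\<exists>y l'. w (line l' y) \<le> b
      \<and> reach w y x (b * ((\<Sum>k\<in>S. \<bar>real_of_int (x $ k)\<bar>) + real (card S * (CARD('n) + 2) * m)))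
      \<and> (\<forall>k\<in>S. \<bar>y $ k\<bar> \<le> int (card S * m)) \<and> (\<forall>k. k \<notin> S \<longrightarrow> \<bar>y $ k\<bar> \<le> \<bar>x $ k\<bar> + int (card S * m))"
proof -
  have "finite S" by simp
  then show ?thesis
  proof (induction S rule: finite_induct)
    case empty
    show ?case
      by (rule exI[of _ x], rule exI[of _ l]) (use l in \<open>auto intro: reach_refl\<close>)
  next
    case (insert k S)
    define c where "c = b * ((\<Sum>k\<in>S. \<bar>real_of_int (x $ k)\<bar>) + real (card S * (CARD('n) + 2) * m))"
    obtain y l' where y: "w (line l' y) \<le> b" "reach w y x c"
      "\<And>k. k \<in> S \<Longrightarrow> \<bar>y $ k\<bar> \<le> int (card S * m)"
      "\<And>k. k \<notin> S \<Longrightarrow> \<bar>y $ k\<bar> \<le> \<bar>x $ k\<bar> + int (card S * m)"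
      using insert.IH unfolding c_def by blast
    have card: "card S \<le> CARD('n)" by (simp add: card_mono)
    have ybox: "y \<in> box R"
      unfolding box_def
    proof safe
      fix j
      have "\<bar>y $ j\<bar> \<le> \<bar>x $ j\<bar> + int (card S * m)"
        using y(3,4)[of j] by (cases "j \<in> S") auto
      also have "card S * m \<le> CARD('n) * m"
        using card by simp
      finally show "\<bar>y $ j\<bar> \<le> int R" using x[of j] by linarith
    qed
    \<comment> \<open>If the current fast line already has direction \<open>k\<close>, no change of line is needed.\<close>
    have "\<exists>s::nat. s \<le> m \<and> w (line k (set_coord l' (y $ l' + int s) y)) \<le> b \<and> (k = l' \<longrightarrow> s = 0)"
    proof (cases "k = l'")
      case True
      then show ?thesis
        using y(1) by (intro exI[of _ 0]) auto
    next
      case False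
      with crossingsE[OF cr ybox, of l' k] show ?thesis
        by (metis less_imp_le)
    qed
    then obtain s :: nat where s: "s \<le> m" "w (line k (set_coord l' (y $ l' + int s) y)) \<le> b" "k = l' \<longrightarrow> s = 0"
      by blast
    define y1 where "y1 = set_coord l' (y $ l' + int s) y"
    have 1: "reach w y1 y (real m * b)"
    proof (rule reach_mono)
      show "reach w y1 y (\<bar>real_of_int ((y $ l' + int s) - y $ l')\<bar> * w (line l' y))"
        unfolding y1_def by (rule reach_line_back)
      show "\<bar>real_of_int ((y $ l' + int s) - y $ l')\<bar> * w (line l' y) \<le> real m * b"
      proof -
        have "real s * w (line l' y) \<le> real s * b"
          using y(1) by (rule mult_left_mono) simp
        also have "\<dots> \<le> real m * b"
          using s(1) b by (intro mult_right_mono) auto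
        finally show ?thesis by simp
      qed
    qed
    have y1k: "y1 $ k = y $ k"
      using s(3) by (auto simp: y1_def)
    have 2: "reach w (set_coord k 0 y1) y1 ((\<bar>real_of_int (x $ k)\<bar> + real (card S * m)) * b)"
    proof (rule reach_mono)
      show "reach w (set_coord k 0 y1) y1 (\<bar>real_of_int (0 - y1 $ k)\<bar> * w (line k y1))"
        by (rule reach_line_back)
      have "\<bar>y $ k\<bar> \<le> \<bar>x $ k\<bar> + int (card S * m)"
        using y(4) insert.hyps by auto
      then have "real_of_int \<bar>y $ k\<bar> \<le> real_of_int (\<bar>x $ k\<bar> + int (card S * m))"
        by (simp only: of_int_le_iff)
      then have le: "\<bar>real_of_int (0 - y1 $ k)\<bar> \<le> \<bar>real_of_int (x $ k)\<bar> + real (card S * m)"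
        by (simp add: y1k)
      have "\<bar>real_of_int (0 - y1 $ k)\<bar> * w (line k y1) \<le> \<bar>real_of_int (0 - y1 $ k)\<bar> * b"
        using s(2) by (intro mult_left_mono) (auto simp: y1_def)
      also have "\<dots> \<le> (\<bar>real_of_int (x $ k)\<bar> + real (card S * m)) * b"
        using le b by (rule mult_right_mono)
      finally show "\<bar>real_of_int (0 - y1 $ k)\<bar> * w (line k y1) \<le> (\<bar>real_of_int (x $ k)\<bar> + real (card S * m)) * b" .
    qed
    have cardI: "card (insert k S) = Suc (card S)"
      using insert.hyps by simp
    have "reach w (set_coord k 0 y1) x ((\<bar>real_of_int (x $ k)\<bar> + real (card S * m)) * b + (real m * b + c))"
      by (rule reach_trans[OF 2 reach_trans[OF 1 y(2)]])
    then have R: "reach w (set_coord k 0 y1) x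
        (b * ((\<Sum>k\<in>insert k S. \<bar>real_of_int (x $ k)\<bar>) + real (card (insert k S) * (CARD('n) + 2) * m)))"
    proof (rule reach_mono)
      have "real (card S * m) * b \<le> real (CARD('n) * m) * b"
        using card b by (intro mult_right_mono of_nat_mono mult_le_mono1)
      moreover have "0 \<le> real m * b" using b by simp
      ultimately show "(\<bar>real_of_int (x $ k)\<bar> + real (card S * m)) * b + (real m * b + c)
         \<le> b * ((\<Sum>k\<in>insert k S. \<bar>real_of_int (x $ k)\<bar>) + real (card (insert k S) * (CARD('n) + 2) * m))"
        unfolding c_def cardI using insert.hyps by (simp add: algebra_simps)
    qed
    have bound: "\<bar>set_coord k 0 y1 $ j\<bar> \<le> (if j = k then 0 else \<bar>y $ j\<bar> + int m)" for j
      using s(1) by (auto simp: y1_def)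
    show ?case
    proof (intro exI[of _ "set_coord k 0 y1"] exI[of _ k] conjI R ballI allI impI)
      show "w (line k (set_coord k 0 y1)) \<le> b"
        using s(2) by (simp add: y1_def)
      show "\<bar>set_coord k 0 y1 $ j\<bar> \<le> int (card (insert k S) * m)" if "j \<in> insert k S" for j
        using bound[of j] y(3)[of j] that unfolding cardI
        by (cases "j = k") (auto simp: algebra_simps)
      show "\<bar>set_coord k 0 y1 $ j\<bar> \<le> \<bar>x $ j\<bar> + int (card (insert k S) * m)" if "j \<notin> insert k S" for j
        using bound[of j] y(4)[of j] that unfolding cardI
        by (auto simp: algebra_simps)
    qed
  qed
qed

section \<open>A linear bound by repeated contraction\<close>

text \<open>
  Three stages: at most \<open>K\<close> steps on the line \<open>line i v\<close> to a line of time at most \<open>k\<close>, then at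
  most \<open>k\<close> steps on that line to a fast one, then the clearing of all coordinates. The box must
  contain the points met on the way, whence the lower bound on \<open>R\<close>. A second direction, and
  so \<open>d \<ge> 2\<close>, is needed in order to change line at all.
\<close>
lemma contraction_step:
  fixes w :: "(int ^ 'n) set \<Rightarrow> real" and v :: "int ^ 'n"
  defines "d \<equiv> CARD('n)"
  assumes d2: "d \<ge> 2" and b: "0 \<le> b" and c: "0 \<le> c"
    and fin: "w (line i v) \<le> c * real_of_int (norm1 v)"
    and B: "crossings w R K (real k)" and C: "crossings w R k b"
    and R: "norm1 v + int (K + k + d * k) \<le> int R"
  shows "\<exists>u. reach w u v ((b + real K * c) * real_of_int (norm1 v) + real k * real k
                + b * real (K + k + d * (d + 2) * k)) \<and> norm1 u \<le> int (d * d * k)"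
proof -
  have "\<exists>j::'n. j \<noteq> i"
  proof (rule ccontr)
    assume "\<nexists>j. j \<noteq> i"
    then have "(UNIV :: 'n set) = {i}" by auto
    then have "CARD('n) = card {i}" by (rule arg_cong)
    then show False using d2 by (simp add: d_def)
  qed
  then obtain j where ij: "i \<noteq> j" by metis
  have "v \<in> box R"
    using R by (intro mem_boxI) linarith
  then obtain s where s: "s < K" "w (line j (set_coord i (v $ i + int s) v)) \<le> real k"
    using crossingsE[OF B _ ij] by blast
  define v1 where "v1 = set_coord i (v $ i + int s) v"
  have l1v1: "norm1 v1 \<le> norm1 v + int K"
    using norm1_set_coord_le[of i "v $ i + int s" v] s(1) unfolding v1_def by linarith
  have "v1 \<in> box R"
    using R l1v1 by (intro mem_boxI) linarith
  then obtain s' where s': "s' < k" "w (line i (set_coord j (v1 $ j + int s') v1)) \<le> b"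
    using crossingsE[OF C _ ij[symmetric]] by blast
  define v2 where "v2 = set_coord j (v1 $ j + int s') v1"
  have l1v2: "norm1 v2 \<le> norm1 v + int (K + k)"
    using norm1_set_coord_le[of j "v1 $ j + int s'" v1] s'(1) l1v1 unfolding v2_def by simp
  have "\<bar>v2 $ m\<bar> + int (CARD('n) * k) \<le> int R" for m
    using abs_nth_le_norm1[of v2 m] l1v2 R by (simp add: d_def)
  from clear_coordinates[OF C b this s'(2)[folded v2_def], of UNIV]
  obtain u where u: "reach w u v2 (b * ((\<Sum>k\<in>UNIV. \<bar>real_of_int (v2 $ k)\<bar>) + real (d * (d + 2) * k)))"
    and ub: "\<And>m. \<bar>u $ m\<bar> \<le> int (d * k)"
    unfolding d_def by auto
  have "norm1 u \<le> (\<Sum>m\<in>(UNIV::'n set). int (d * k))"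
    unfolding norm1_def by (rule sum_mono) (rule ub)
  then have l1u: "norm1 u \<le> int (d * d * k)"
    by (simp add: d_def)
  have "(\<Sum>k\<in>UNIV. \<bar>real_of_int (v2 $ k)\<bar>) = real_of_int (norm1 v2)"
    by (simp add: norm1_def)
  also have "\<dots> \<le> real_of_int (norm1 v + int (K + k))"
    using l1v2 by (simp only: of_int_le_iff)
  finally have "b * ((\<Sum>k\<in>UNIV. \<bar>real_of_int (v2 $ k)\<bar>) + real (d * (d + 2) * k))
      \<le> b * (real_of_int (norm1 v) + real (K + k) + real (d * (d + 2) * k))"
    using b by (intro mult_left_mono) auto
  with u have r3: "reach w u v2 (b * (real_of_int (norm1 v) + real (K + k) + real (d * (d + 2) * k)))"
    by (rule reach_mono)
  have r2: "reach w v2 v1 (real k * real k)"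
  proof (rule reach_mono)
    show "reach w v2 v1 (\<bar>real_of_int ((v1 $ j + int s') - v1 $ j)\<bar> * w (line j v1))"
      unfolding v2_def by (rule reach_line_back)
    have "real s' * w (line j v1) \<le> real s' * real k"
      using s(2) by (intro mult_left_mono) (auto simp: v1_def)
    also have "\<dots> \<le> real k * real k"
      using s'(1) by (intro mult_right_mono) auto
    finally show "\<bar>real_of_int ((v1 $ j + int s') - v1 $ j)\<bar> * w (line j v1) \<le> real k * real k"
      by simp
  qed
  have r1: "reach w v1 v (real K * c * real_of_int (norm1 v))"
  proof (rule reach_mono)
    show "reach w v1 v (\<bar>real_of_int ((v $ i + int s) - v $ i)\<bar> * w (line i v))"
      unfolding v1_def by (rule reach_line_back)
    have "real s * w (line i v) \<le> real s * (c * real_of_int (norm1 v))"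
      using fin by (intro mult_left_mono) auto
    also have "\<dots> \<le> real K * (c * real_of_int (norm1 v))"
      using s(1) c by (intro mult_right_mono) auto
    finally show "\<bar>real_of_int ((v $ i + int s) - v $ i)\<bar> * w (line i v) \<le> real K * c * real_of_int (norm1 v)"
      by simp
  qed
  have "reach w u v (b * (real_of_int (norm1 v) + real (K + k) + real (d * (d + 2) * k))
      + (real k * real k + real K * c * real_of_int (norm1 v)))"
    by (rule reach_trans[OF r3 reach_trans[OF r2 r1]])
  then have "reach w u v ((b + real K * c) * real_of_int (norm1 v) + real k * real k
                + b * real (K + k + d * (d + 2) * k))"
    by (rule reach_mono) (simp add: algebra_simps)
  with l1u show ?thesis by blast
qed

lemma ex_cube_bracket: "\<exists>k. k ^ 3 \<le> n \<and> n < (k + 1) ^ 3" for n :: nat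
proof -
  define k where "k = (LEAST k. n < (k + 1) ^ 3)"
  have ex: "n < (n + 1) ^ 3"
    by (rule less_le_trans[of _ "n + 1"]) (auto intro: self_le_power)
  have "n < (k + 1) ^ 3"
    unfolding k_def by (rule LeastI[of "\<lambda>k. n < (k + 1) ^ 3", OF ex])
  moreover have "k ^ 3 \<le> n"
  proof (cases k)
    case (Suc m)
    then have "\<not> n < (m + 1) ^ 3"
      unfolding k_def using not_less_Least by (metis lessI)
    then show ?thesis using Suc by simp
  qed simp
  ultimately show ?thesis by blast
qed

text \<open>
  Strong induction on \<open>\<parallel>v\<parallel>\<^sub>1\<close>, where \<open>contraction_step\<close> replaces \<open>v\<close> by a point of norm at most
  \<open>d\<^sup>2 k\<close>, with \<open>k\<close> the cube root of \<open>\<parallel>v\<parallel>\<^sub>1\<close> rounded down. One \<open>\<eta>\<close> pays for the slow line at \<open>v\<close>,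
  the other one for all terms of order \<open>k\<^sup>2\<close>.
\<close>
lemma reach_linear_bound:
  fixes w :: "(int ^ 'n) set \<Rightarrow> real"
  defines "d \<equiv> CARD('n)"
  assumes d2: "d \<ge> 2" and b: "0 \<le> b" and \<eta>: "0 < \<eta>" and K: "K > 0"
    and A: "finite {v. \<not> (\<exists>i. w (line i v) \<le> \<eta> / real K * real_of_int (norm1 v))}"
    and B: "\<forall>\<^sub>F k in sequentially. crossings w ((K + d + 3) * (k + 1) ^ 3) K (real k)"
    and C: "\<forall>\<^sub>F k in sequentially. crossings w ((K + d + 3) * (k + 1) ^ 3) k b"
  shows "\<exists>c0. \<forall>v. reach w 0 v (c0 + (b + 2 * \<eta>) * real_of_int (norm1 v))"
proof -
  \<comment> \<open>\<open>E k\<^sup>2\<close> bounds the search on the line of time \<open>k\<close>, the detours on fast lines, and the linear bound at \<open>u\<close>.\<close>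
  define E where "E = 1 + b * (real K + 1 + real (d * (d + 2))) + (b + 2 * \<eta>) * real (d * d)"
  have E: "\<forall>\<^sub>F k in sequentially. real k ^ 2 * E \<le> \<eta> * real k ^ 3"
  proof (rule eventually_mono)
    show "\<forall>\<^sub>F k in sequentially. real k \<ge> E / \<eta>"
      by real_asymp
    fix k assume "E / \<eta> \<le> real k"
    then have "E \<le> \<eta> * real k"
      using \<eta> by (simp add: field_simps)
    then have "real k ^ 2 * E \<le> real k ^ 2 * (\<eta> * real k)"
      by (rule mult_left_mono) simp
    then show "real k ^ 2 * E \<le> \<eta> * real k ^ 3"
      by (simp add: power2_eq_square power3_eq_cube mult_ac)
  qed
  have "\<forall>\<^sub>F k in sequentially. d * d < k \<and> 1 \<le> k"
    by (intro eventually_conj eventually_gt_at_top eventually_ge_at_top)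
  with B C E have "\<forall>\<^sub>F k in sequentially. crossings w ((K + d + 3) * (k + 1) ^ 3) K (real k) \<and>
      crossings w ((K + d + 3) * (k + 1) ^ 3) k b \<and> real k ^ 2 * E \<le> \<eta> * real k ^ 3 \<and> d * d < k \<and> 1 \<le> k"
    by eventually_elim auto
  then obtain k0 where k0: "\<And>k. k \<ge> k0 \<Longrightarrow> crossings w ((K + d + 3) * (k + 1) ^ 3) K (real k) \<and>
      crossings w ((K + d + 3) * (k + 1) ^ 3) k b \<and> real k ^ 2 * E \<le> \<eta> * real k ^ 3 \<and> d * d < k \<and> 1 \<le> k"
    unfolding eventually_sequentially by blast
  define Bad where "Bad = {v. \<not> (\<exists>i. w (line i v) \<le> \<eta> / real K * real_of_int (norm1 v))} \<union> {v. norm1 v < int (k0 ^ 3)}"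
  have "{v :: int ^ 'n. norm1 v < int (k0 ^ 3)} \<subseteq> box (k0 ^ 3)"
    by (auto intro: mem_boxI)
  then have finBad: "finite Bad"
    unfolding Bad_def using A finite_subset[OF _ finite_box] by blast
  have "\<forall>v. \<exists>c. reach w 0 v c"
    by (auto intro: ex_reach)
  then obtain f where f: "\<And>v. reach w 0 v (f v)"
    by metis
  define c0 where "c0 = (\<Sum>v\<in>Bad. \<bar>f v\<bar>)"
  have bp: "0 \<le> b + 2 * \<eta>" using b \<eta> by simp
  have "reach w 0 v (c0 + (b + 2 * \<eta>) * real_of_int (norm1 v))" for v
  proof (induction "nat (norm1 v)" arbitrary: v rule: less_induct)
    case less
    show ?case
    proof (cases "v \<in> Bad")
      case True
      have "f v \<le> \<bar>f v\<bar>" by simp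
      also have "\<dots> \<le> c0"
        unfolding c0_def using finBad True by (intro member_le_sum) auto
      also have "\<dots> \<le> c0 + (b + 2 * \<eta>) * real_of_int (norm1 v)"
        using bp by simp
      finally show ?thesis
        using f reach_mono by blast
    next
      case False
      then obtain i where i: "w (line i v) \<le> \<eta> / real K * real_of_int (norm1 v)"
        and big: "int (k0 ^ 3) \<le> norm1 v"
        unfolding Bad_def by auto
      obtain k where k: "k ^ 3 \<le> nat (norm1 v)" "nat (norm1 v) < (k + 1) ^ 3"
        using ex_cube_bracket by blast
      have "k0 ^ 3 < (k + 1) ^ 3"
        using k(2) big by linarith
      then have kk0: "k0 \<le> k"
        by (metis less_Suc_eq_le Suc_eq_plus1 power_less_imp_less_base zero_le)
      note k0' = k0[OF kk0]
      have "k \<le> (k + 1) ^ 3" "1 \<le> (k + 1) ^ 3"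
        by (rule le_trans[of _ "k + 1"]) (auto intro: self_le_power)
      then have "K * 1 \<le> K * (k + 1) ^ 3" "d * k \<le> d * (k + 1) ^ 3" "k \<le> (k + 1) ^ 3"
        by (blast intro: mult_le_mono2)+
      then have "nat (norm1 v) + (K + k + d * k) \<le> (K + d + 3) * (k + 1) ^ 3"
        using k(2) unfolding distrib_right by linarith
      then have R: "norm1 v + int (K + k + d * k) \<le> int ((K + d + 3) * (k + 1) ^ 3)"
        using norm1_nonneg[of v] by linarith
      have "\<exists>u. reach w u v ((b + real K * (\<eta> / real K)) * real_of_int (norm1 v) + real k * real k
                + b * real (K + k + CARD('n) * (CARD('n) + 2) * k)) \<and> norm1 u \<le> int (CARD('n) * CARD('n) * k)"
        by (rule contraction_step) (use d2 b \<eta> i k0' R in \<open>auto simp: d_def\<close>)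
      then obtain u where u: "reach w u v ((b + \<eta>) * real_of_int (norm1 v) + real k * real k
                + b * real (K + k + d * (d + 2) * k))" and l1u: "norm1 u \<le> int (d * d * k)"
        using K by (auto simp: d_def)
      have "d * d * k < k ^ 3"
      proof -
        have "d * d * k < k * k"
          using k0' by simp
        also have "\<dots> \<le> k ^ 3"
          using k0' by (simp add: power3_eq_cube)
        finally show ?thesis .
      qed
      then have "nat (norm1 u) < nat (norm1 v)"
        using l1u k(1) by linarith
      from less[OF this] have "reach w 0 u (c0 + (b + 2 * \<eta>) * real_of_int (norm1 u))" .
      from reach_trans[OF this u] have "reach w 0 v (c0 + (b + 2 * \<eta>) * real_of_int (norm1 u) +
          ((b + \<eta>) * real_of_int (norm1 v) + real k * real k + b * real (K + k + d * (d + 2) * k)))" .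
      then show ?thesis
      proof (rule reach_mono)
        have "real_of_int (norm1 u) \<le> real (d * d * k)"
          using l1u by (metis of_int_le_iff of_int_of_nat_eq)
        then have 1: "(b + 2 * \<eta>) * real_of_int (norm1 u) \<le> (b + 2 * \<eta>) * real (d * d * k)"
          using bp by (rule mult_left_mono)
        have kk: "real k \<le> real k ^ 2" "1 \<le> real k ^ 2"
          using k0' by (auto simp: self_le_power)
        have "b * real (K + k + d * (d + 2) * k) = (b * real K) * 1 + (b * (1 + real (d * (d + 2)))) * real k"
          by (simp add: algebra_simps)
        also have "\<dots> \<le> (b * real K) * real k ^ 2 + (b * (1 + real (d * (d + 2)))) * real k ^ 2"
          using kk b by (intro add_mono mult_left_mono) auto
        finally have 2: "b * real (K + k + d * (d + 2) * k) \<le> real k ^ 2 * (b * (real K + 1 + real (d * (d + 2))))"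
          by (simp add: algebra_simps)
        have "(b + 2 * \<eta>) * real (d * d * k) = ((b + 2 * \<eta>) * real (d * d)) * real k"
          by simp
        also have "\<dots> \<le> ((b + 2 * \<eta>) * real (d * d)) * real k ^ 2"
          using kk bp by (intro mult_left_mono) auto
        finally have 3: "(b + 2 * \<eta>) * real (d * d * k) \<le> real k ^ 2 * ((b + 2 * \<eta>) * real (d * d))"
          by (simp add: mult_ac)
        have "real (k ^ 3) \<le> real_of_int (norm1 v)"
          using k(1) norm1_nonneg[of v] by linarith
        then have "\<eta> * real k ^ 3 \<le> \<eta> * real_of_int (norm1 v)"
          using \<eta> by (intro mult_left_mono) auto
        then have "real k ^ 2 * E \<le> \<eta> * real_of_int (norm1 v)"
          using k0' by linarith
        moreover have "real k ^ 2 * E = real k * real k + real k ^ 2 * (b * (real K + 1 + real (d * (d + 2))))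
            + real k ^ 2 * ((b + 2 * \<eta>) * real (d * d))"
          unfolding E_def by (simp add: distrib_left power2_eq_square)
        ultimately have "(b + 2 * \<eta>) * real_of_int (norm1 u) + (real k * real k + b * real (K + k + d * (d + 2) * k))
            \<le> \<eta> * real_of_int (norm1 v)"
          using 1 2 3 by linarith
        moreover have "(b + 2 * \<eta>) * real_of_int (norm1 v) = (b + \<eta>) * real_of_int (norm1 v) + \<eta> * real_of_int (norm1 v)"
          by (simp add: algebra_simps)
        ultimately show "c0 + (b + 2 * \<eta>) * real_of_int (norm1 u) +
          ((b + \<eta>) * real_of_int (norm1 v) + real k * real k + b * real (K + k + d * (d + 2) * k))
            \<le> c0 + (b + 2 * \<eta>) * real_of_int (norm1 v)"
          by linarith
      qed
    qed
  qed
  then show ?thesis by blast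
qed

section \<open>Independent line times\<close>

lemma iid_cdf_le_one:
  assumes "iid_with_cdf M X I F" "i \<in> I"
  shows "F r \<le> 1"
proof -
  interpret prob_space M
    using assms by (simp add: iid_with_cdf_def)
  have "X i \<in> borel_measurable M" "F = cdf (distr M borel (X i))"
    using assms by (auto simp: iid_with_cdf_def indep_vars_def)
  then show ?thesis
    by (simp add: cdf_def measure_distr)
qed

lemma iid_prob_all_greater:
  assumes iid: "iid_with_cdf M X I F" and J: "J \<subseteq> I" "finite J"
  shows "{\<omega>\<in>space M. \<forall>j\<in>J. r < X j \<omega>} \<in> sets M"
    and "measure M {\<omega>\<in>space M. \<forall>j\<in>J. r < X j \<omega>} = (1 - F r) ^ card J"
proof -
  interpret prob_space M
    using iid by (simp add: iid_with_cdf_def)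
  have ind: "indep_vars (\<lambda>_. borel) X I" and F: "\<And>i. i \<in> I \<Longrightarrow> cdf (distr M borel (X i)) = F"
    using iid by (auto simp: iid_with_cdf_def)
  have rv [measurable]: "X i \<in> borel_measurable M" if "i \<in> I" for i
    using ind that by (auto simp: indep_vars_def)
  have single: "prob (X i -` {r<..} \<inter> space M) = 1 - F r" if "i \<in> I" for i
  proof -
    have "F r = prob (X i -` {..r} \<inter> space M)"
      unfolding F[OF that, symmetric] cdf_def using rv[OF that] by (simp add: measure_distr)
    moreover have "X i -` {r<..} \<inter> space M = space M - (X i -` {..r} \<inter> space M)"
      by auto
    ultimately show ?thesis
      using rv[OF that] by (simp add: prob_compl)
  qed
  have eq: "{\<omega>\<in>space M. \<forall>j\<in>J. r < X j \<omega>} = (\<Inter>j\<in>J. X j -` {r<..} \<inter> space M)" if "J \<noteq> {}"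
    using that by auto
  show "{\<omega>\<in>space M. \<forall>j\<in>J. r < X j \<omega>} \<in> sets M"
    using J by (intro sets.sets_Collect_finite_All) auto
  show "measure M {\<omega>\<in>space M. \<forall>j\<in>J. r < X j \<omega>} = (1 - F r) ^ card J"
  proof (cases "J = {}")
    case True
    then show ?thesis by (simp add: prob_space)
  next
    case False
    have "prob (\<Inter>j\<in>J. X j -` {r<..} \<inter> space M) = (\<Prod>j\<in>J. prob (X j -` {r<..} \<inter> space M))"
      by (rule indep_varsD[OF ind]) (use J False in auto)
    also have "\<dots> = (\<Prod>j\<in>J. 1 - F r)"
      using J single by (intro prod.cong) auto
    finally show ?thesis
      using eq[OF False] by simp
  qed
qed

text \<open>
  This serves both the departure from a vertex (\<open>Z k\<close> is one vertex, \<open>D k z\<close> the lines through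
  it) and the search for faster lines (\<open>Z k\<close> is a box of starting points with pairs of
  directions, \<open>D k z\<close> the lines that are crossed). By independence all variables in \<open>D k z\<close>
  exceed \<open>r k\<close> with probability \<open>(1 - F (r k)) ^ m k\<close>; a union bound over \<open>Z k\<close> completes the
  estimate.
\<close>
lemma iid_Borel_Cantelli:
  assumes iid: "iid_with_cdf M X I F"
    and Z: "\<And>k. finite (Z k)"
    and D: "\<And>k z. z \<in> Z k \<Longrightarrow> D k z \<subseteq> I \<and> finite (D k z) \<and> card (D k z) = m k"
    and sum: "summable (\<lambda>k. real (card (Z k)) * (1 - F (r k)) ^ m k)"
  shows "AE \<omega> in M. \<forall>\<^sub>F k in sequentially. \<forall>z\<in>Z k. \<exists>\<delta>\<in>D k z. X \<delta> \<omega> \<le> r k"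
proof -
  interpret prob_space M
    using iid by (simp add: iid_with_cdf_def)
  define A where "A k = (\<Union>z\<in>Z k. {\<omega>\<in>space M. \<forall>\<delta>\<in>D k z. r k < X \<delta> \<omega>})" for k
  have sets: "{\<omega>\<in>space M. \<forall>\<delta>\<in>D k z. r k < X \<delta> \<omega>} \<in> sets M" if "z \<in> Z k" for k z
    using D[OF that] by (intro iid_prob_all_greater[OF iid]) auto
  have A [measurable]: "A k \<in> sets M" for k
    unfolding A_def using Z sets by (intro sets.finite_UN) auto
  have "prob (A k) \<le> real (card (Z k)) * (1 - F (r k)) ^ m k" for k
  proof -
    have "prob (A k) \<le> (\<Sum>z\<in>Z k. prob {\<omega>\<in>space M. \<forall>\<delta>\<in>D k z. r k < X \<delta> \<omega>})"
      unfolding A_def using Z sets by (intro finite_measure_subadditive_finite) auto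
    also have "\<dots> = (\<Sum>z\<in>Z k. (1 - F (r k)) ^ m k)"
      using D by (intro sum.cong) (auto simp: iid_prob_all_greater(2)[OF iid])
    finally show ?thesis by simp
  qed
  then have "summable (\<lambda>k. prob (A k))"
    by (intro summable_comparison_test'[OF sum, of 0]) auto
  then have "AE \<omega> in M. \<forall>\<^sub>F k in sequentially. \<omega> \<in> space M - A k"
    by (intro borel_cantelli_AE1) (auto simp: emeasure_eq_measure)
  then show ?thesis
  proof eventually_elim
    case (elim \<omega>)
    then show ?case
      by eventually_elim (auto simp: A_def not_less)
  qed
qed

lemma summable_power_times_geometric:
  fixes q :: real
  assumes "0 \<le> q" "q < 1"
  shows "summable (\<lambda>k. real ((k + 1) ^ n) * q ^ k)"
proof -
  define p where "p = (q + 1) / 2"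
  have p: "0 < p" "p < 1" "q \<le> p" using assms by (auto simp: p_def)
  have "summable (\<lambda>k. real ((k + 1) ^ n) * p ^ k)"
  proof (rule summable_comparison_test_bigo)
    show "summable (\<lambda>k. norm (1 / real k ^ 2))"
      using inverse_power_summable[of 2, where 'a=real] by (simp add: field_simps)
    show "(\<lambda>k. real ((k + 1) ^ n) * p ^ k) \<in> O(\<lambda>k. 1 / real k ^ 2)"
      using p by real_asymp
  qed
  then show ?thesis
    using p assms by (rule_tac summable_comparison_test'[of _ 0]) (auto intro!: mult_left_mono power_mono)
qed

text \<open>
  The lines in a search, and the lines through one vertex, must be distinct: only then do their
  times form an independent family.
\<close>
lemma inj_line: "inj (\<lambda>i. line i x)"
proof (rule injI, rule ccontr)
  fix i j assume "line i x = line j x" "i \<noteq> j"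
  moreover have "set_coord i (x $ i + 1) x \<in> line i x" by (simp add: line_def)
  ultimately have "set_coord i (x $ i + 1) x $ i = x $ i" unfolding line_def by blast
  then show False by simp
qed

lemma inj_crossing_lines:
  assumes "i \<noteq> j"
  shows "inj (\<lambda>s::nat. line j (set_coord i (x $ i + int s) x))"
proof (rule injI)
  fix s s' :: nat
  assume eq: "line j (set_coord i (x $ i + int s) x) = line j (set_coord i (x $ i + int s') x)"
  have "set_coord i (x $ i + int s) x \<in> line j (set_coord i (x $ i + int s) x)"
    by (simp add: line_def)
  then have "set_coord i (x $ i + int s) x \<in> line j (set_coord i (x $ i + int s') x)"
    by (simp only: eq)
  then have "set_coord i (x $ i + int s) x $ i = set_coord i (x $ i + int s') x $ i"
    using assms unfolding line_def mem_Collect_eq by blast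
  then show "s = s'" by simp
qed

text \<open>
  The box has \<open>O(k\<^sup>3\<^sup>d)\<close> points, so a constant multiple of the series that is assumed to
  converge dominates the one in \<open>iid_Borel_Cantelli\<close>.
\<close>
lemma AE_crossings:
  fixes \<tau> :: "(int ^ 'n) set \<Rightarrow> 'w \<Rightarrow> real"
  assumes iid: "iid_with_cdf M \<tau> integer_lines F"
    and sum: "summable (\<lambda>k. real ((k + 1) ^ (3 * CARD('n))) * (1 - F (r k)) ^ m k)"
  shows "AE \<omega> in M. \<forall>\<^sub>F k in sequentially. crossings (\<lambda>\<delta>. \<tau> \<delta> \<omega>) (C * (k + 1) ^ 3) (m k) (r k)"
proof -
  define P where "P = {(i, j). i \<noteq> (j :: 'n)}"
  define Z where "Z k = (box (C * (k + 1) ^ 3) :: (int ^ 'n) set) \<times> P" for k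
  define D where "D k = (\<lambda>(x :: int ^ 'n, i, j). (\<lambda>s. line j (set_coord i (x $ i + int s) x)) ` {..<m k})" for k
  have prob01: "0 \<le> (1 - F x) ^ n" for x n
    using iid_cdf_le_one[OF iid line_in_integer_lines] by simp
  have "AE \<omega> in M. \<forall>\<^sub>F k in sequentially. \<forall>z\<in>Z k. \<exists>\<delta>\<in>D k z. \<tau> \<delta> \<omega> \<le> r k"
  proof (rule iid_Borel_Cantelli[OF iid])
    show "finite (Z k)" for k
      by (simp add: Z_def finite_box)
    show "D k z \<subseteq> integer_lines \<and> finite (D k z) \<and> card (D k z) = m k" if "z \<in> Z k" for k z
    proof -
      obtain x i j where z: "z = (x, i, j)" "i \<noteq> j"
        using \<open>z \<in> Z k\<close> by (auto simp: Z_def P_def)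
      show ?thesis
        using card_image[OF inj_on_subset[OF inj_crossing_lines[OF z(2), of x]], of "{..<m k}"]
        by (auto simp: D_def z)
    qed
    show "summable (\<lambda>k. real (card (Z k)) * (1 - F (r k)) ^ m k)"
    proof (rule summable_comparison_test')
      show "summable (\<lambda>k. (real ((2 * C + 1) ^ CARD('n)) * real (card P)) * (real ((k + 1) ^ (3 * CARD('n))) * (1 - F (r k)) ^ m k))"
        using sum by (rule summable_mult)
      show "norm (real (card (Z k)) * (1 - F (r k)) ^ m k)
        \<le> (real ((2 * C + 1) ^ CARD('n)) * real (card P)) * (real ((k + 1) ^ (3 * CARD('n))) * (1 - F (r k)) ^ m k)" if "k \<ge> 0" for k
      proof -
        have "card (Z k) = (2 * (C * (k + 1) ^ 3) + 1) ^ CARD('n) * card P"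
          by (simp add: Z_def card_cartesian_product card_box)
        also have "\<dots> \<le> ((2 * C + 1) * (k + 1) ^ 3) ^ CARD('n) * card P"
          by (intro mult_le_mono1 power_mono) (simp_all add: distrib_right)
        also have "\<dots> = (2 * C + 1) ^ CARD('n) * card P * (k + 1) ^ (3 * CARD('n))"
          by (simp only: power_mult power_mult_distrib) (simp only: mult_ac)
        finally have "real (card (Z k)) \<le> real ((2 * C + 1) ^ CARD('n) * card P * (k + 1) ^ (3 * CARD('n)))"
          by (simp only: of_nat_le_iff)
        then have "real (card (Z k)) * (1 - F (r k)) ^ m k
          \<le> real ((2 * C + 1) ^ CARD('n) * card P * (k + 1) ^ (3 * CARD('n))) * (1 - F (r k)) ^ m k"
          using prob01 by (rule mult_right_mono)
        then show ?thesis
          using prob01[of "r k" "m k"] by (simp only: of_nat_mult mult.assoc real_norm_def abs_mult abs_of_nat abs_of_nonneg)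
      qed
    qed
  qed
  then show ?thesis
  proof eventually_elim
    case (elim \<omega>)
    then show ?case
      by eventually_elim (force simp: crossings_def Z_def D_def P_def)
  qed
qed

section \<open>The moment condition\<close>

text \<open>
  With \<open>y = \<rho>\<^sup>d\<close>, the points of \<open>V\<close> lie in a box of side length \<open>2 \<rho> / c + 1\<close>, and
  the power \<open>(2 \<rho> / c + 1)\<^sup>d\<close> is bounded by an affine function of \<open>y\<close>. This is why the integrability of a \<open>d\<close>-th power is
  the right condition in dimension \<open>d\<close>.
\<close>
lemma lattice_count_le:
  fixes V :: "(int ^ 'n) set"
  assumes "finite V" and c: "0 < c"
    and V: "\<And>v. v \<in> V \<Longrightarrow> (c * real_of_int (norm1 v)) ^ CARD('n) < y"
  shows "real (card V) \<le> (4 / c) ^ CARD('n) * \<bar>y\<bar> + 2 ^ CARD('n)"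
proof (cases "V = {}")
  case True
  then show ?thesis using c by simp
next
  case False
  define d where "d = CARD('n)"
  have d: "0 < d" by (simp add: d_def)
  obtain v where "v \<in> V" using False by blast
  then have y: "0 < y"
    using V[of v] c by (smt (verit) zero_le_power mult_nonneg_nonneg of_int_nonneg norm1_nonneg)
  define \<rho> where "\<rho> = root d y"
  have \<rho>: "0 \<le> \<rho>" "\<rho> ^ d = y"
    using d y by (auto simp: \<rho>_def)
  define R where "R = nat \<lfloor>\<rho> / c\<rfloor>"
  have "V \<subseteq> box R"
    unfolding box_def
  proof safe
    fix v i assume "v \<in> V"
    then have "(c * real_of_int (norm1 v)) ^ d < \<rho> ^ d"
      using V \<rho> by (simp add: d_def)
    then have "c * real_of_int (norm1 v) < \<rho>"
      using \<rho>(1) by (rule power_less_imp_less_base)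
    then have "real_of_int (norm1 v) \<le> \<rho> / c"
      using c by (simp add: field_simps)
    then have "norm1 v \<le> \<lfloor>\<rho> / c\<rfloor>"
      by (simp add: le_floor_iff)
    then show "\<bar>v $ i\<bar> \<le> int R"
      unfolding R_def using abs_nth_le_norm1[of v i] by linarith
  qed
  then have "card V \<le> (2 * R + 1) ^ d"
    unfolding d_def card_box[symmetric] by (rule card_mono[OF finite_box])
  then have "real (card V) \<le> real ((2 * R + 1) ^ d)"
    by (simp only: of_nat_le_iff)
  also have "\<dots> = (2 * real R + 1) ^ d"
    by (simp add: add.commute)
  also have "real R \<le> \<rho> / c"
    unfolding R_def using \<rho>(1) c by (intro of_nat_floor) simp
  then have "(2 * real R + 1) ^ d \<le> (2 * (\<rho> / c) + 1) ^ d"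
    by (intro power_mono) auto
  also have "\<dots> \<le> (4 * \<rho> / c) ^ d + 2 ^ d"
  proof (cases "2 * (\<rho> / c) \<le> 1")
    case True
    then have "(2 * (\<rho> / c) + 1) ^ d \<le> 2 ^ d"
      using \<rho>(1) c by (intro power_mono) auto
    moreover have "0 \<le> (4 * \<rho> / c) ^ d"
      using \<rho>(1) c by simp
    ultimately show ?thesis by linarith
  next
    case False
    moreover have "4 * \<rho> / c = 4 * (\<rho> / c)"
      by simp
    ultimately have "2 * (\<rho> / c) + 1 \<le> 4 * \<rho> / c"
      by linarith
    then have "(2 * (\<rho> / c) + 1) ^ d \<le> (4 * \<rho> / c) ^ d"
      using \<rho>(1) c by (intro power_mono) auto
    moreover have "0 \<le> (2::real) ^ d" by simp
    ultimately show ?thesis by linarith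
  qed
  also have "(4 * \<rho> / c) ^ d = (4 / c) ^ d * \<bar>y\<bar>"
    using \<rho>(2) y by (simp add: power_divide power_mult_distrib)
  finally show ?thesis by (simp add: d_def)
qed

text \<open>
  Only an inequality, because an even power also makes negative values large.
\<close>
lemma iid_min_power_tail:
  fixes \<sigma> :: "'n::finite \<Rightarrow> 'v \<Rightarrow> real"
  assumes iid: "iid_with_cdf N \<sigma> UNIV F" and r: "0 \<le> r"
    and Y: "Y = (\<lambda>\<omega>. Min (range (\<lambda>i. \<sigma> i \<omega> ^ CARD('n))))" and int: "integrable N Y"
  shows "(1 - F r) ^ CARD('n) \<le> measure N {\<omega>\<in>space N. r ^ CARD('n) < Y \<omega>}"
proof -
  interpret prob_space N
    using iid by (simp add: iid_with_cdf_def)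
  have [measurable]: "Y \<in> borel_measurable N"
    using int by simp
  have "(1 - F r) ^ CARD('n) = prob {\<omega>\<in>space N. \<forall>j\<in>UNIV. r < \<sigma> j \<omega>}"
    by (simp add: iid_prob_all_greater(2)[OF iid, of UNIV r, simplified])
  also have "\<dots> \<le> prob {\<omega>\<in>space N. r ^ CARD('n) < Y \<omega>}"
  proof (rule finite_measure_mono)
    show "{\<omega>\<in>space N. \<forall>j\<in>UNIV. r < \<sigma> j \<omega>} \<subseteq> {\<omega>\<in>space N. r ^ CARD('n) < Y \<omega>}"
      using r by (auto simp: Y intro!: power_strict_mono)
  qed measurable
  finally show ?thesis .
qed

text \<open>
  The tail of one line time is thus at most of order \<open>1/r\<close>, which makes a fixed number of
  crossings sufficient at the intermediate scale.
\<close>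
lemma iid_tail_bound:
  fixes \<sigma> :: "'n::finite \<Rightarrow> 'v \<Rightarrow> real"
  assumes iid: "iid_with_cdf N \<sigma> UNIV F" and r: "0 < r"
    and Y: "Y = (\<lambda>\<omega>. Min (range (\<lambda>i. \<sigma> i \<omega> ^ CARD('n))))" and int: "integrable N Y"
  shows "(1 - F r) ^ CARD('n) \<le> (\<integral>\<omega>. \<bar>Y \<omega>\<bar> \<partial>N) / r ^ CARD('n)"
proof -
  interpret prob_space N
    using iid by (simp add: iid_with_cdf_def)
  have [measurable]: "Y \<in> borel_measurable N"
    using int by simp
  have "(1 - F r) ^ CARD('n) \<le> prob {\<omega>\<in>space N. r ^ CARD('n) < Y \<omega>}"
    using r by (intro iid_min_power_tail[OF iid _ Y int]) simp
  also have "\<dots> \<le> prob {\<omega>\<in>space N. r ^ CARD('n) \<le> \<bar>Y \<omega>\<bar>}"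
    by (intro finite_measure_mono) auto
  also have "\<dots> \<le> (\<integral>\<omega>. \<bar>Y \<omega>\<bar> \<partial>N) / r ^ CARD('n)"
    using r int by (intro integral_Markov_inequality_measure[where A = "{}"]) auto
  finally show ?thesis .
qed

text \<open>
  The sum of tail probabilities is at most the expected number of \<open>v\<close> with
  \<open>(c \<parallel>v\<parallel>\<^sub>1)\<^sup>d < Y\<close>, to which \<open>lattice_count_le\<close> applies pointwise. The bound does not depend on
  the finite set \<open>V\<close>, so the series over the whole lattice converges.
\<close>
lemma iid_tail_lattice_sum:
  fixes \<sigma> :: "'n::finite \<Rightarrow> 'v \<Rightarrow> real" and V :: "(int ^ 'n) set"
  assumes iid: "iid_with_cdf N \<sigma> UNIV F" and c: "0 < c" and V: "finite V"
    and Y: "Y = (\<lambda>\<omega>. Min (range (\<lambda>i. \<sigma> i \<omega> ^ CARD('n))))" and int: "integrable N Y"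
  shows "(\<Sum>v\<in>V. (1 - F (c * real_of_int (norm1 v))) ^ CARD('n))
      \<le> (4 / c) ^ CARD('n) * (\<integral>\<omega>. \<bar>Y \<omega>\<bar> \<partial>N) + 2 ^ CARD('n)"
proof -
  interpret prob_space N
    using iid by (simp add: iid_with_cdf_def)
  have [measurable]: "Y \<in> borel_measurable N"
    using int by simp
  define A where "A v = {\<omega>\<in>space N. (c * real_of_int (norm1 v)) ^ CARD('n) < Y \<omega>}" for v :: "int ^ 'n"
  have [measurable]: "A v \<in> sets N" for v
    unfolding A_def by measurable
  have "(\<Sum>v\<in>V. (1 - F (c * real_of_int (norm1 v))) ^ CARD('n)) \<le> (\<Sum>v\<in>V. prob (A v))"
    unfolding A_def using c by (intro sum_mono iid_min_power_tail[OF iid _ Y int]) simp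
  also have "\<dots> = (\<integral>\<omega>. (\<Sum>v\<in>V. indicator (A v) \<omega>) \<partial>N)"
    by (subst Bochner_Integration.integral_sum) (auto simp: emeasure_eq_measure)
  also have "\<dots> \<le> (\<integral>\<omega>. (4 / c) ^ CARD('n) * \<bar>Y \<omega>\<bar> + 2 ^ CARD('n) \<partial>N)"
  proof (rule integral_mono)
    fix \<omega> assume "\<omega> \<in> space N"
    have "(\<Sum>v\<in>V. indicator (A v) \<omega>) = real (card {v\<in>V. \<omega> \<in> A v})"
      using V by (simp add: indicator_def sum.If_cases Int_def)
    also have "\<dots> \<le> (4 / c) ^ CARD('n) * \<bar>Y \<omega>\<bar> + 2 ^ CARD('n)"
      using V c by (intro lattice_count_le) (auto simp: A_def)
    finally show "(\<Sum>v\<in>V. indicator (A v) \<omega>) \<le> (4 / c) ^ CARD('n) * \<bar>Y \<omega>\<bar> + 2 ^ CARD('n)" .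
  qed (use int in \<open>auto simp: emeasure_eq_measure\<close>)
  also have "\<dots> = (4 / c) ^ CARD('n) * (\<integral>\<omega>. \<bar>Y \<omega>\<bar> \<partial>N) + 2 ^ CARD('n)"
    using int by (simp add: prob_space)
  finally show ?thesis .
qed

text \<open>
  The variables \<open>\<sigma> i\<close> may live on another probability space than the line times; the two are
  linked only by \<open>F\<close>, through \<open>P(all d lines through v are slower than r) = (1 - F r)\<^sup>d\<close>.
\<close>
lemma AE_slow_stars_finite:
  fixes \<tau> :: "(int ^ 'n) set \<Rightarrow> 'w \<Rightarrow> real" and \<sigma> :: "'n \<Rightarrow> 'v \<Rightarrow> real"
  assumes iid: "iid_with_cdf M \<tau> integer_lines F" and iid': "iid_with_cdf N \<sigma> UNIV F"
    and int: "integrable N (\<lambda>\<omega>. Min (range (\<lambda>i. \<sigma> i \<omega> ^ CARD('n))))" and c: "0 < c"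
  shows "AE \<omega> in M. finite {v. \<not> (\<exists>i. \<tau> (line i v) \<omega> \<le> c * real_of_int (norm1 v))}"
proof -
  define f where "f = from_nat_into (UNIV :: (int ^ 'n) set)"
  have "infinite (UNIV :: (int ^ 'n) set)"
  proof
    assume "finite (UNIV :: (int ^ 'n) set)"
    then have "finite (range (\<lambda>t. set_coord undefined t (0 :: int ^ 'n)))"
      by (rule finite_subset[rotated]) simp
    moreover have "inj (\<lambda>t. set_coord undefined t (0 :: int ^ 'n))"
      by (rule injI) (metis set_coord_nth)
    ultimately show False
      using finite_imageD infinite_UNIV_int by blast
  qed
  then have f: "bij f"
    unfolding f_def by (intro bij_betw_from_nat_into) auto
  have "AE \<omega> in M. \<forall>\<^sub>F k in sequentially. \<forall>v\<in>{f k}. \<exists>\<delta>\<in>range (\<lambda>i. line i v). \<tau> \<delta> \<omega> \<le> c * real_of_int (norm1 (f k))"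
  proof (rule iid_Borel_Cantelli[OF iid, where m = "\<lambda>_. CARD('n)"])
    show "range (\<lambda>i. line i v) \<subseteq> integer_lines \<and> finite (range (\<lambda>i. line i v))
        \<and> card (range (\<lambda>i. line i v)) = CARD('n)" for v :: "int ^ 'n"
      by (auto simp: card_image[OF inj_line])
    have "summable (\<lambda>k. (1 - F (c * real_of_int (norm1 (f k)))) ^ CARD('n))"
    proof (rule summableI_nonneg_bounded)
      show "0 \<le> (1 - F (c * real_of_int (norm1 (f k)))) ^ CARD('n)" for k
        using iid_cdf_le_one[OF iid' UNIV_I] by simp
      show "(\<Sum>k<n. (1 - F (c * real_of_int (norm1 (f k)))) ^ CARD('n))
        \<le> (4 / c) ^ CARD('n) * (\<integral>\<omega>. \<bar>Min (range (\<lambda>i. \<sigma> i \<omega> ^ CARD('n)))\<bar> \<partial>N) + 2 ^ CARD('n)" for n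
      proof -
        have "(\<Sum>k<n. (1 - F (c * real_of_int (norm1 (f k)))) ^ CARD('n))
          = (\<Sum>v\<in>f ` {..<n}. (1 - F (c * real_of_int (norm1 v))) ^ CARD('n))"
          using f by (subst sum.reindex) (auto simp: bij_def inj_on_def)
        also have "\<dots> \<le> (4 / c) ^ CARD('n) * (\<integral>\<omega>. \<bar>Min (range (\<lambda>i. \<sigma> i \<omega> ^ CARD('n)))\<bar> \<partial>N) + 2 ^ CARD('n)"
          by (rule iid_tail_lattice_sum[OF iid' c _ refl int]) simp
        finally show ?thesis .
      qed
    qed
    then show "summable (\<lambda>k. real (card {f k}) * (1 - F (c * real_of_int (norm1 (f k)))) ^ CARD('n))"
      by simp
  qed auto
  then show ?thesis
  proof eventually_elim
    case (elim \<omega>)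
    then obtain n0 where n0: "\<And>n. n \<ge> n0 \<Longrightarrow> \<exists>i. \<tau> (line i (f n)) \<omega> \<le> c * real_of_int (norm1 (f n))"
      unfolding eventually_sequentially by auto
    have "{v. \<not> (\<exists>i. \<tau> (line i v) \<omega> \<le> c * real_of_int (norm1 v))} \<subseteq> f ` {..<n0}"
    proof
      fix v assume v: "v \<in> {v. \<not> (\<exists>i. \<tau> (line i v) \<omega> \<le> c * real_of_int (norm1 v))}"
      obtain n where "v = f n" using f by (metis bij_is_surj surjD)
      with v n0[of n] show "v \<in> f ` {..<n0}" by (cases "n < n0") auto
    qed
    then show ?case by (rule finite_subset) simp
  qed
qed

section \<open>The almost sure linear bound\<close>

text \<open>
  The number \<open>K\<close> of crossings is a multiple of \<open>d\<close> because the moment bounds the power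
  \<open>(1 - F k)\<^sup>d\<close>: raised to \<open>3 d + 2\<close>, this is at most of order \<open>k\<^sup>-\<^sup>3\<^sup>d\<^sup>-\<^sup>2\<close>, which beats
  the \<open>O(k\<^sup>3\<^sup>d)\<close> points of the box by a summable factor \<open>k\<^sup>-\<^sup>2\<close>.
\<close>
lemma AE_reach_linear_bound:
  fixes \<tau> :: "(int ^ 'n) set \<Rightarrow> 'w \<Rightarrow> real" and \<sigma> :: "'n \<Rightarrow> 'v \<Rightarrow> real"
  assumes dim: "CARD('n) \<ge> 2" and iid: "iid_with_cdf M \<tau> integer_lines F" and iid': "iid_with_cdf N \<sigma> UNIV F"
    and int: "integrable N (\<lambda>\<omega>. Min (range (\<lambda>i. \<sigma> i \<omega> ^ CARD('n))))"
    and b: "0 \<le> b" "0 < F b" and \<eta>: "0 < \<eta>"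
  shows "AE \<omega> in M. \<exists>c0. \<forall>v. reach (\<lambda>\<delta>. \<tau> \<delta> \<omega>) 0 v (c0 + (b + 2 * \<eta>) * real_of_int (norm1 v))"
proof -
  define d where "d = CARD('n)"
  define K where "K = d * (3 * d + 2)"
  define E where "E = (\<integral>\<omega>. \<bar>Min (range (\<lambda>i. \<sigma> i \<omega> ^ CARD('n)))\<bar> \<partial>N)"
  have K: "K > 0" using dim by (simp add: K_def d_def)
  have E: "0 \<le> E" by (simp add: E_def)
  have q: "0 \<le> 1 - F r" for r
    using iid_cdf_le_one[OF iid' UNIV_I] by simp
  have "AE \<omega> in M. finite {v. \<not> (\<exists>i. \<tau> (line i v) \<omega> \<le> \<eta> / real K * real_of_int (norm1 v))}"
    using \<eta> K by (intro AE_slow_stars_finite[OF iid iid' int]) simp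
  moreover have "AE \<omega> in M. \<forall>\<^sub>F k in sequentially. crossings (\<lambda>\<delta>. \<tau> \<delta> \<omega>) ((K + d + 3) * (k + 1) ^ 3) K (real k)"
  proof (rule AE_crossings[OF iid])
    show "summable (\<lambda>k. real ((k + 1) ^ (3 * CARD('n))) * (1 - F (real k)) ^ K)"
    proof (rule summable_comparison_test')
      show "summable (\<lambda>k. 2 ^ (3 * d) * E ^ (3 * d + 2) * inverse (real k ^ 2))"
        using inverse_power_summable[of 2, where 'a = real] by (intro summable_mult) (simp add: power_inverse)
      show "norm (real ((k + 1) ^ (3 * CARD('n))) * (1 - F (real k)) ^ K)
         \<le> 2 ^ (3 * d) * E ^ (3 * d + 2) * inverse (real k ^ 2)" if "k \<ge> 1" for k
      proof -
        have k: "real k > 0" using that by simp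
        have "(1 - F (real k)) ^ K = ((1 - F (real k)) ^ d) ^ (3 * d + 2)"
          by (simp only: K_def power_mult)
        also have "\<dots> \<le> (E / real k ^ d) ^ (3 * d + 2)"
          using iid_tail_bound[OF iid' k refl int] q by (intro power_mono) (auto simp: E_def d_def)
        also have "\<dots> = E ^ (3 * d + 2) / (real k ^ d) ^ (3 * d + 2)"
          by (rule power_divide)
        also have "\<dots> \<le> E ^ (3 * d + 2) / real k ^ (3 * d + 2)"
          using that E dim by (intro divide_left_mono power_mono) (auto simp: d_def intro!: self_le_power)
        finally have 1: "(1 - F (real k)) ^ K \<le> E ^ (3 * d + 2) / real k ^ (3 * d + 2)" .
        have "real ((k + 1) ^ (3 * d)) = (real k + 1) ^ (3 * d)"
          by (simp add: add.commute)
        also have "\<dots> \<le> (2 * real k) ^ (3 * d)"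
          using that by (intro power_mono) auto
        finally have "real ((k + 1) ^ (3 * d)) * (1 - F (real k)) ^ K
           \<le> (2 * real k) ^ (3 * d) * (E ^ (3 * d + 2) / real k ^ (3 * d + 2))"
          using 1 q by (intro mult_mono) auto
        also have "\<dots> = 2 ^ (3 * d) * E ^ (3 * d + 2) * inverse (real k ^ 2)"
          using k by (simp only: power_mult_distrib power_add) (simp add: field_simps)
        finally show ?thesis
          using q[of "real k"] by (simp add: d_def)
      qed
    qed
  qed
  moreover have "AE \<omega> in M. \<forall>\<^sub>F k in sequentially. crossings (\<lambda>\<delta>. \<tau> \<delta> \<omega>) ((K + d + 3) * (k + 1) ^ 3) k b"
    using q b(2) by (intro AE_crossings[OF iid] summable_power_times_geometric) auto
  ultimately show ?thesis
  proof eventually_elim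
    case (elim \<omega>)
    then show ?case
      using dim K b(1) \<eta> unfolding d_def by (intro reach_linear_bound[of b \<eta> K]) auto
  qed
qed

section \<open>The infimum of the support\<close>

text \<open>
  By the Lindelof property, the complement is a countable union of open null sets.
\<close>
lemma complement_support_null:
  fixes \<mu> :: "'a::second_countable_topology measure"
  assumes "sets \<mu> = sets borel"
  shows "- measure_support \<mu> \<in> null_sets \<mu>"
proof -
  define \<U> where "\<U> = {U. open U \<and> emeasure \<mu> U = 0}"
  have "- measure_support \<mu> = \<Union>\<U>"
    by (auto simp: measure_support_def \<U>_def zero_less_iff_neq_zero)
  moreover obtain \<V> where "\<V> \<subseteq> \<U>" "countable \<V>" "\<Union>\<V> = \<Union>\<U>"
    using Lindelof[of \<U>] by (auto simp: \<U>_def)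
  moreover from this have "\<Union>\<V> \<in> null_sets \<mu>"
    using assms null_sets_UN'[of \<V> "\<lambda>U. U" \<mu>] by (auto simp: \<U>_def null_sets_def subset_iff)
  ultimately show ?thesis by simp
qed

lemma real_distribution_Inf_support:
  assumes "real_distribution \<mu>" and nonneg: "AE x in \<mu>. 0 \<le> x" and a: "a = Inf (measure_support \<mu>)"
  shows "0 \<le> a" "AE x in \<mu>. a \<le> x" "0 < \<eta> \<Longrightarrow> 0 < cdf \<mu> (a + \<eta>)"
proof -
  interpret real_distribution \<mu> by fact
  have null: "AE x in \<mu>. x \<in> measure_support \<mu>"
    using AE_not_in[OF complement_support_null[of \<mu>]] by simp
  have ne: "measure_support \<mu> \<noteq> {}"
  proof
    assume "measure_support \<mu> = {}"
    with null have "AE x in \<mu>. False" by simp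
    then show False by simp
  qed
  have lb: "0 \<le> x" if "x \<in> measure_support \<mu>" for x
  proof (rule ccontr)
    assume "\<not> 0 \<le> x"
    then have "0 < emeasure \<mu> {..<0}"
      using that by (auto simp: measure_support_def)
    moreover have "{..<0} \<in> null_sets \<mu>"
      using nonneg by (subst AE_iff_null_sets) (auto simp: not_less)
    then have "emeasure \<mu> {..<0} = 0"
      by (rule null_setsD1)
    ultimately show False by simp
  qed
  then have bdd: "bdd_below (measure_support \<mu>)" by (rule bdd_belowI)
  show "0 \<le> a"
    unfolding a using ne lb by (rule cInf_greatest)
  show "AE x in \<mu>. a \<le> x"
    using null by eventually_elim (auto simp: a intro: cInf_lower bdd)
  show "0 < cdf \<mu> (a + \<eta>)" if \<eta>: "0 < \<eta>"
  proof -
    obtain x where x: "x \<in> measure_support \<mu>" "x < a + \<eta>"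
      using \<eta> ne bdd cInf_less_iff[of "measure_support \<mu>" "a + \<eta>"] a by auto
    then have "0 < emeasure \<mu> {..<a + \<eta>}"
      by (auto simp: measure_support_def)
    also have "\<dots> \<le> emeasure \<mu> {..a + \<eta>}"
      by (intro emeasure_mono) auto
    finally show ?thesis
      by (simp add: cdf_def emeasure_eq_measure)
  qed
qed

lemma interval_measure_cdf:
  assumes "real_distribution \<mu>"
  shows "interval_measure (cdf \<mu>) = \<mu>"
proof -
  interpret real_distribution \<mu> by fact
  show ?thesis
    by (intro cdf_unique real_distribution_interval_measure assms)
       (auto simp: cdf_interval_measure cdf_nondecreasing cdf_is_right_cont cdf_lim_at_bot cdf_lim_at_top_prob)
qed

section \<open>Rounding, and the shape of the ball\<close>

lemma norm1_cell_vertex_le: "real_of_int (norm1 (cell_vertex x)) \<le> (\<Sum>i\<in>UNIV. \<bar>x $ i\<bar>) + real CARD('n)"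
  for x :: "real ^ 'n"
proof -
  have "real_of_int (norm1 (cell_vertex x)) = (\<Sum>i\<in>UNIV. \<bar>real_of_int \<lfloor>x $ i\<rfloor>\<bar>)"
    by (simp add: norm1_def cell_vertex_def)
  also have "\<dots> \<le> (\<Sum>i\<in>UNIV. \<bar>x $ i\<bar> + 1)"
    by (rule sum_mono) linarith
  finally show ?thesis by (simp add: sum.distrib)
qed

lemma cell_vertex_zero [simp]: "cell_vertex 0 = 0"
  by (simp add: cell_vertex_def vec_eq_iff)

lemma mem_scaled_iff:
  assumes "t > 0"
  shows "x \<in> scaled (1 / t) S \<longleftrightarrow> t *\<^sub>R x \<in> S"
proof
  assume "t *\<^sub>R x \<in> S"
  then have "(1 / t) *\<^sub>R (t *\<^sub>R x) \<in> scaled (1 / t) S" unfolding scaled_def by blast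
  then show "x \<in> scaled (1 / t) S" using assms by simp
qed (use assms in \<open>auto simp: scaled_def\<close>)

text \<open>
  The constant \<open>c0\<close> and the rounding error are bounded, whereas the slack \<open>(1 - s r) t\<close> grows
  with \<open>t\<close>.
\<close>
lemma diamond_subset_scaled_ball:
  fixes w :: "(int ^ 'n) set \<Rightarrow> real"
  assumes w: "\<And>\<delta>. \<delta> \<in> integer_lines \<Longrightarrow> 0 \<le> w \<delta>"
    and reach: "\<And>v. reach w 0 v (c0 + s * real_of_int (norm1 v))" and s: "0 \<le> s" "s * r < 1"
  shows "\<forall>\<^sub>F t in at_top. diamond r \<subseteq> scaled (1 / t) (fpp_ball w t)"
proof -
  define C where "C = c0 + s * real CARD('n)"
  have "\<forall>\<^sub>F t in at_top. t > 0 \<and> C / (1 - s * r) \<le> t"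
    by (intro eventually_conj eventually_gt_at_top eventually_ge_at_top)
  then show ?thesis
  proof eventually_elim
    case (elim t)
    then have t: "t > 0" and C: "C \<le> t * (1 - s * r)"
      using s by (auto simp: field_simps)
    show ?case
    proof
      fix x :: "real ^ 'n" assume x: "x \<in> diamond r"
      have "(\<Sum>i\<in>UNIV. \<bar>(t *\<^sub>R x) $ i\<bar>) = t * (\<Sum>i\<in>UNIV. \<bar>x $ i\<bar>)"
        using t by (simp add: abs_mult sum_distrib_left)
      also have "\<dots> \<le> t * r"
        using x t by (simp add: diamond_def)
      finally have "real_of_int (norm1 (cell_vertex (t *\<^sub>R x))) \<le> t * r + real CARD('n)"
        using norm1_cell_vertex_le[of "t *\<^sub>R x"] by linarith
      then have "s * real_of_int (norm1 (cell_vertex (t *\<^sub>R x))) \<le> s * (t * r + real CARD('n))"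
        using s(1) by (rule mult_left_mono)
      then have "c0 + s * real_of_int (norm1 (cell_vertex (t *\<^sub>R x))) \<le> t"
        using C by (simp add: C_def algebra_simps)
      with reach[of "cell_vertex (t *\<^sub>R x)"] have "passage_time w 0 (t *\<^sub>R x) \<le> t"
        using w by (intro passage_time_le) (auto intro: reach_mono)
      then show "x \<in> scaled (1 / t) (fpp_ball w t)"
        using t by (simp add: mem_scaled_iff fpp_ball_def)
    qed
  qed
qed

lemma scaled_ball_subset_diamond:
  fixes w :: "(int ^ 'n) set \<Rightarrow> real"
  assumes w: "\<And>\<delta>. \<delta> \<in> integer_lines \<Longrightarrow> a \<le> w \<delta>" and a: "0 < a" and t: "0 < t"
  shows "scaled (1 / t) (fpp_ball w t \<inter> lattice_points) \<subseteq> diamond (1 / a)"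
    and "scaled (1 / t) (fpp_ball w t) \<subseteq> {u + v | u v. u \<in> diamond (1 / a) \<and> v \<in> scaled (1 / t) unit_cell}"
proof -
  define z where "z x = (\<chi> i. real_of_int \<lfloor>x $ i\<rfloor>)" for x :: "real ^ 'n"
  have z: "(1 / t) *\<^sub>R z y \<in> diamond (1 / a)" if "y \<in> fpp_ball w t" for y
  proof -
    have "a * real_of_int (norm1 (cell_vertex y - cell_vertex 0)) \<le> passage_time w 0 y"
      using w a by (intro passage_time_ge) auto
    also have "\<dots> \<le> t" using that by (simp add: fpp_ball_def)
    finally have "real_of_int (norm1 (cell_vertex y)) / t \<le> 1 / a"
      using a t by (simp add: field_simps)
    moreover have "(\<Sum>i\<in>UNIV. \<bar>((1 / t) *\<^sub>R z y) $ i\<bar>) = real_of_int (norm1 (cell_vertex y)) / t"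
      using t by (simp add: z_def norm1_def cell_vertex_def sum_divide_distrib)
    ultimately show ?thesis
      by (simp add: diamond_def)
  qed
  show "scaled (1 / t) (fpp_ball w t \<inter> lattice_points) \<subseteq> diamond (1 / a)"
  proof
    fix x assume "x \<in> scaled (1 / t) (fpp_ball w t \<inter> lattice_points)"
    then obtain y where y: "x = (1 / t) *\<^sub>R y" "y \<in> fpp_ball w t" "y \<in> lattice_points"
      unfolding scaled_def by blast
    have "z y = y"
      using y(3) by (simp add: z_def lattice_points_def vec_eq_iff)
    with z[OF y(2)] y(1) show "x \<in> diamond (1 / a)" by simp
  qed
  show "scaled (1 / t) (fpp_ball w t) \<subseteq> {u + v | u v. u \<in> diamond (1 / a) \<and> v \<in> scaled (1 / t) unit_cell}"
  proof
    fix x assume "x \<in> scaled (1 / t) (fpp_ball w t)"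
    then obtain y where y: "x = (1 / t) *\<^sub>R y" "y \<in> fpp_ball w t"
      unfolding scaled_def by blast
    have "y - z y \<in> unit_cell"
      by (auto simp: unit_cell_def z_def) linarith
    then have "(1 / t) *\<^sub>R (y - z y) \<in> scaled (1 / t) unit_cell"
      unfolding scaled_def by blast
    moreover have "x = (1 / t) *\<^sub>R z y + (1 / t) *\<^sub>R (y - z y)"
      unfolding y(1) by (simp add: scaleR_diff_right)
    ultimately show "x \<in> {u + v | u v. u \<in> diamond (1 / a) \<and> v \<in> scaled (1 / t) unit_cell}"
      using z[OF y(2)] by blast
  qed
qed

theorem theorem1p9:
  fixes M :: "'w measure" and \<tau> :: "(int ^ 'n) set \<Rightarrow> 'w \<Rightarrow> real"
    and N :: "'v measure" and \<sigma> :: "'n \<Rightarrow> 'v \<Rightarrow> real"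
    and F :: "real \<Rightarrow> real" and a :: real
  assumes dim: "CARD('n) \<ge> 2"
    and fpp: "brochette_fpp M \<tau> F"
    and a: "a = Inf (measure_support (interval_measure F))"
    and iid: "iid_with_cdf N \<sigma> UNIV F"
    and moment: "integrable N (\<lambda>\<omega>. Min (range (\<lambda>i. \<sigma> i \<omega> ^ CARD('n))))"
  shows "(a > 0 \<longrightarrow> (\<forall>\<epsilon>>0. AE \<omega> in M. \<forall>\<^sub>F t in at_top.
             diamond ((1 - \<epsilon>) / a) \<subseteq> scaled (1 / t) (fpp_ball (\<lambda>\<delta>. \<tau> \<delta> \<omega>) t) \<and>
             scaled (1 / t) (fpp_ball (\<lambda>\<delta>. \<tau> \<delta> \<omega>) t \<inter> lattice_points) \<subseteq> diamond (1 / a) \<and>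
             scaled (1 / t) (fpp_ball (\<lambda>\<delta>. \<tau> \<delta> \<omega>) t)
               \<subseteq> {u + v | u v. u \<in> diamond (1 / a) \<and> v \<in> scaled (1 / t) unit_cell})) \<and>
         (a = 0 \<longrightarrow> (\<forall>K>0. AE \<omega> in M. \<forall>\<^sub>F t in at_top.
             diamond K \<subseteq> scaled (1 / t) (fpp_ball (\<lambda>\<delta>. \<tau> \<delta> \<omega>) t)))"
proof -
  have iid\<tau>: "iid_with_cdf M \<tau> integer_lines F"
    and nonneg: "\<And>\<delta> \<omega>. \<delta> \<in> integer_lines \<Longrightarrow> \<omega> \<in> space M \<Longrightarrow> 0 \<le> \<tau> \<delta> \<omega>"
    using fpp by (auto simp: brochette_fpp_def)
  interpret prob_space M
    using iid\<tau> by (simp add: iid_with_cdf_def)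
  have rv: "\<tau> \<delta> \<in> borel_measurable M" if "\<delta> \<in> integer_lines" for \<delta>
    using iid\<tau> that by (auto simp: iid_with_cdf_def indep_vars_def)
  have law: "real_distribution (interval_measure F)" "cdf (interval_measure F) = F"
      "distr M borel (\<tau> \<delta>) = interval_measure F" if "\<delta> \<in> integer_lines" for \<delta>
  proof -
    have D: "real_distribution (distr M borel (\<tau> \<delta>))" "cdf (distr M borel (\<tau> \<delta>)) = F"
      using rv[OF that] iid\<tau> that by (auto simp: iid_with_cdf_def)
    then have "interval_measure F = distr M borel (\<tau> \<delta>)"
      using interval_measure_cdf by metis
    with D show "real_distribution (interval_measure F)" "cdf (interval_measure F) = F"
      "distr M borel (\<tau> \<delta>) = interval_measure F" by simp_all
  qed
  obtain \<delta>0 :: "(int ^ 'n) set" where \<delta>0: "\<delta>0 \<in> integer_lines"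
    using line_in_integer_lines by blast
  have AE_nonneg: "AE x in interval_measure F. 0 \<le> x"
    using nonneg[OF \<delta>0] rv[OF \<delta>0] unfolding law(3)[OF \<delta>0, symmetric] by (subst AE_distr_iff) auto
  note supp = real_distribution_Inf_support[OF law(1)[OF \<delta>0] AE_nonneg a]
  have pos: "0 < F (a + \<eta>)" if "0 < \<eta>" for \<eta>
    using supp(3)[OF that] by (simp add: law(2)[OF \<delta>0])
  have "AE \<omega> in M. a \<le> \<tau> \<delta> \<omega>" if "\<delta> \<in> integer_lines" for \<delta>
    using supp(2) rv[OF that] unfolding law(3)[OF that, symmetric] by (subst (asm) AE_distr_iff) auto
  moreover have "countable (integer_lines :: (int ^ 'n) set set)"
  proof -
    have "integer_lines \<subseteq> (\<lambda>(i :: 'n, x). line i x) ` UNIV"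
      by (force elim: integer_linesE)
    then show ?thesis by (rule countable_subset) simp
  qed
  ultimately have lower: "AE \<omega> in M. \<forall>\<delta>\<in>integer_lines. a \<le> \<tau> \<delta> \<omega>"
    by (simp add: AE_ball_countable)
  have upper: "AE \<omega> in M. \<forall>\<^sub>F t in at_top. diamond r \<subseteq> scaled (1 / t) (fpp_ball (\<lambda>\<delta>. \<tau> \<delta> \<omega>) t)"
    if \<eta>: "0 < \<eta>" "(a + 3 * \<eta>) * r < 1" for \<eta> r
  proof -
    have "AE \<omega> in M. \<exists>c0. \<forall>v. reach (\<lambda>\<delta>. \<tau> \<delta> \<omega>) 0 v (c0 + ((a + \<eta>) + 2 * \<eta>) * real_of_int (norm1 v))"
      using supp(1) pos \<eta> by (intro AE_reach_linear_bound[OF dim iid\<tau> iid moment]) auto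
    with AE_space show ?thesis
    proof eventually_elim
      case (elim \<omega>)
      then obtain c0 where c0: "\<And>v. reach (\<lambda>\<delta>. \<tau> \<delta> \<omega>) 0 v (c0 + (a + 3 * \<eta>) * real_of_int (norm1 v))"
        by (auto simp: algebra_simps)
      show ?case
        by (rule diamond_subset_scaled_ball[OF _ c0]) (use elim nonneg \<eta> supp(1) in auto)
    qed
  qed
  show ?thesis
  proof (intro conjI impI allI)
    fix \<epsilon> :: real assume a: "a > 0" and \<epsilon>: "\<epsilon> > 0"
    \<comment> \<open>With \<open>\<eta> = a \<epsilon> / 6\<close> the slope becomes \<open>a (1 + \<epsilon> / 2)\<close>, which the factor \<open>1 - \<epsilon>\<close> outweighs.\<close>
    have "(a + 3 * (a * \<epsilon> / 6)) * ((1 - \<epsilon>) / a) = (1 + \<epsilon> / 2) * (1 - \<epsilon>)"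
      using a by (simp add: field_simps)
    also have "\<dots> = 1 - \<epsilon> / 2 - \<epsilon> * \<epsilon> / 2"
      by (simp add: field_simps)
    also have "\<dots> < 1"
      using \<epsilon> mult_pos_pos[OF \<epsilon> \<epsilon>] by linarith
    finally have "AE \<omega> in M. \<forall>\<^sub>F t in at_top. diamond ((1 - \<epsilon>) / a) \<subseteq> scaled (1 / t) (fpp_ball (\<lambda>\<delta>. \<tau> \<delta> \<omega>) t)"
      using a \<epsilon> by (intro upper[of "a * \<epsilon> / 6"]) auto
    with lower show "AE \<omega> in M. \<forall>\<^sub>F t in at_top.
             diamond ((1 - \<epsilon>) / a) \<subseteq> scaled (1 / t) (fpp_ball (\<lambda>\<delta>. \<tau> \<delta> \<omega>) t) \<and>
             scaled (1 / t) (fpp_ball (\<lambda>\<delta>. \<tau> \<delta> \<omega>) t \<inter> lattice_points) \<subseteq> diamond (1 / a) \<and>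
             scaled (1 / t) (fpp_ball (\<lambda>\<delta>. \<tau> \<delta> \<omega>) t)
               \<subseteq> {u + v | u v. u \<in> diamond (1 / a) \<and> v \<in> scaled (1 / t) unit_cell}"
    proof eventually_elim
      case (elim \<omega>)
      then have w: "a \<le> \<tau> \<delta> \<omega>" if "\<delta> \<in> integer_lines" for \<delta>
        using that by blast
      from elim(2) eventually_gt_at_top[of 0] show ?case
        by eventually_elim (intro conjI scaled_ball_subset_diamond[OF w a])
    qed
  next
    fix K :: real assume "a = 0" "K > 0"
    then show "AE \<omega> in M. \<forall>\<^sub>F t in at_top. diamond K \<subseteq> scaled (1 / t) (fpp_ball (\<lambda>\<delta>. \<tau> \<delta> \<omega>) t)"
      by (intro upper[of "1 / (6 * K)"]) auto
  qed
qed



end
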